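(* Let $b$ be a prime, let $m,s,d\in\mathbb{N}$ with $d>1$, let $\alpha>1$ be an integer, let $\boldsymbol{\gamma}=(\gamma_v)_{v\subseteq\{1:s\}}$ be a set of weights, let $p\in\mathbb{F}_b[x]$ with $\deg(p)=m$ and $\boldsymbol{q}\in(\mathbb{F}_b[x])^{ds}$. Let $\mathcal{D}_d(P_{b^m,ds}(\boldsymbol{q},p))$ be the interlaced polynomial lattice point set of order $d$ and let $D^\perp_{\boldsymbol{q},p}$ be the dual polynomial lattice of $P_{b^m,ds}(\boldsymbol{q},p)$. The worst-case error for numerical integration in $\mathcal{W}_{s,\alpha,\boldsymbol{\gamma}}$ using $\mathcal{D}_d(P_{b^m,ds}(\boldsymbol{q},p))$ is bounded as $$e(\mathcal{D}_d(P_{b^m,ds}(\boldsymbol{q},p)),\mathcal{W}_{s,\alpha,\boldsymbol{\gamma}})\le\sum_{\emptyset\ne u\subseteq\{1:ds\}}\tilde\gamma_{w(u)}\sum_{\substack{\boldsymbol{k}_u\in\mathbb{N}^{|u|}\\(\boldsymbol{k}_u,\boldsymbol{0})\in D^\perp_{\boldsymbol{q},p}}}\tilde r_{\alpha,d,(1)}(\boldsymbol{k}_u),$$ where $\tilde\gamma_{w(u)}:=\gamma_{w(u)}b^{\alpha(2d-1)|w(u)|/2}$.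
   Context: $\mathbb{N}$ is the set of positive integers, $\mathbb{N}_0=\mathbb{N}\cup\{0\}$, $\{a:c\}=\{a,a+1,\ldots,c\}$; $\mathbb{F}_b$ is the field with $b$ elements, identified with $\{0,1,\ldots,b-1\}$. All $b$-adic expansions of reals in $[0,1)$ are the unique ones with infinitely many digits different from $b-1$. A non-negative integer $k=\kappa_0+\cdots+\kappa_{a-1}b^{a-1}$ is identified with $k(x)=\kappa_0+\cdots+\kappa_{a-1}x^{a-1}\in\mathbb{F}_b[x]$. Polynomial lattice: $v_m(\sum_{l=w}^\infty t_lx^{-l})=\sum_{l=\max(1,w)}^m t_lb^{-l}$ for formal Laurent series over $\mathbb{F}_b$. $P_{b^m,ds}(\boldsymbol{q},p)$ consists of $\boldsymbol{z}_n=(z_{n,1},\ldots,z_{n,ds})$, $z_{n,j}=v_m(n(x)q_j(x)/p(x))$, $0\le n<b^m$. Interlacing: for $y_r=\sum_{a\ge1}y_{r,a}b^{-a}\in[0,1)$, $\mathcal{D}_d(y_1,\ldots,y_d)=\sum_{a=1}^\infty\sum_{r=1}^dy_{r,a}b^{-r-(a-1)d}$, applied to vectors in $[0,1)^{ds}$ on each of the $s$ consecutive blocks of $d$ components. $\mathcal{D}_d(P_{b^m,ds}(\boldsymbol{q},p))$ consists of the points $\mathcal{D}_d(\boldsymbol{z}_n)\in[0,1)^s$, $0\le n<b^m$. Dual lattice: $\mathrm{tr}_m(k)=\kappa_0+\kappa_1x+\cdots+\kappa_{m-1}x^{m-1}$ for $k$ with $b$-adic digits $\kappa_i$; $D^\perp_{\boldsymbol{q},p}=\{\boldsymbol{k}\in\mathbb{N}_0^{ds}:\sum_{j=1}^{ds}\mathrm{tr}_m(k_j)q_j\equiv0\pmod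 p\}$. $(\boldsymbol{k}_u,\boldsymbol{0})\in\mathbb{N}_0^{ds}$ has components $0$ outside $u$. For $u\subseteq\{1:ds\}$, $w(u)$ is the set of $1\le j\le s$ with $u\cap\{(j-1)d+1:jd\}\ne\emptyset$. Walsh functions: with $\omega_b=e^{2\pi\mathrm{i}/b}$, $\mathrm{wal}_k(x)=\omega_b^{x_1\kappa_0+\cdots+x_a\kappa_{a-1}}$ for $k=\kappa_0+\cdots+\kappa_{a-1}b^{a-1}$, $x=\sum_i x_ib^{-i}$; $\mathrm{wal}_{\boldsymbol{k}}(\boldsymbol{x})=\prod_j\mathrm{wal}_{k_j}(x_j)$. Walsh coefficients of $f\in L_2([0,1)^s)$: $\hat f(\boldsymbol{l})=\int_{[0,1)^s}f(\boldsymbol{x})\overline{\mathrm{wal}_{\boldsymbol{l}}(\boldsymbol{x})}\,\mathrm{d}\boldsymbol{x}$. $\mu_\alpha$, $r_\alpha$, $\tilde r_{\alpha,d,(1)}$: for an integer $\alpha\ge1$ and $k=\kappa_1b^{a_1-1}+\cdots+\kappa_\nu b^{a_\nu-1}\in\mathbb{N}$ with $\nu\ge1$, $1\le a_\nu<\cdots<a_1$ and $\kappa_i\in\{1,\ldots,b-1\}$, $\mu_\alpha(k)=a_1+\cdots+a_{\min(\nu,\alpha)}$ (so $\mu_1(k)=a_1$); $\mu_\alpha(0)=0$; $r_\alpha(k)=b^{-\mu_\alpha(k)}$; for vectors, $r_\alpha$ is the product over components. Further $\tilde r_{\alpha,d,(1)}(0)=1$, $\tilde r_{\alpha,d,(1)}(k)=b^{-\min(\alpha,d)\mu_1(k)-\alpha/2}$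 for $k\ge1$, and $\tilde r_{\alpha,d,(1)}(\boldsymbol{k}_u)=\prod_{j\in u}\tilde r_{\alpha,d,(1)}(k_j)$. Weighted Walsh space: $\mathcal{W}_{s,\alpha,\boldsymbol{\gamma}}$ is the function space consisting of functions $f:[0,1)^s\to\mathbb{R}$ for which the norm $$\|f\|_{\mathcal{W}_{s,\alpha,\boldsymbol{\gamma}}}=\max_{v\subseteq\{1:s\},\,\gamma_v\ne0}\gamma_v^{-1}\sup_{\boldsymbol{l}_v\in\mathbb{N}^{|v|}}\frac{|\hat f(\boldsymbol{l}_v,\boldsymbol{0})|}{r_\alpha(\boldsymbol{l}_v)}$$ is finite, where $(\boldsymbol{l}_v,\boldsymbol{0})\in\mathbb{N}_0^s$ has components $0$ outside $v$. For functions in this space the Walsh series $\sum_{\boldsymbol{l}\in\mathbb{N}_0^s}\hat f(\boldsymbol{l})\mathrm{wal}_{\boldsymbol{l}}(\boldsymbol{x})$ is taken to converge to $f$ pointwise absolutely. Worst-case error: for $P=\{\boldsymbol{x}_0,\ldots,\boldsymbol{x}_{N-1}\}$, $e(P,\mathcal{W}_{s,\alpha,\boldsymbol{\gamma}})=\sup\left|\frac1N\sum_{n=0}^{N-1}f(\boldsymbol{x}_n)-\int_{[0,1)^s}f(\boldsymbol{x})\,\mathrm{d}\boldsymbol{x}\right|$ over $f\in\mathcal{W}_{s,\alpha,\boldsymbol{\gamma}}$ with $\|f\|_{\mathcal{W}_{s,\alpha,\boldsymbol{\gamma}}}\le1$.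
   Formalization: If some weight γ_v is 0, functions in the space are also required to have vanishing Walsh coefficients f̂(l_v,0) for that v; without this the worst-case error is infinite for nonempty such v and the bound fails. *)

theory Defs
  imports
    "HOL-Analysis.Analysis"
    "HOL-Computational_Algebra.Formal_Laurent_Series"
    "Berlekamp_Zassenhaus.Finite_Field"
begin

text \<open>
  Vectors with components indexed by \<open>{1..n}\<close> are extensional functions on \<open>{1..n}\<close>.
  The field \<open>F\<^sub>b\<close> is \<open>'b mod_ring\<close> with \<open>b = CARD('b)\<close> prime (type class \<open>prime_card\<close>); its
  identification with \<open>{0, \<dots>, b-1}\<close> is \<open>to_int_mod_ring\<close> in one direction and \<open>of_nat\<close> in the other.
\<close>

subsection \<open>Digits\<close>

text \<open>Digit of \<open>b^i\<close> in a natural number, and digit of \<open>b^(-i)\<close> (for \<open>i \<ge> 1\<close>) in \<open>x \<in> [0,1)\<close>.\<close>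

definition nat_digit :: "nat \<Rightarrow> nat \<Rightarrow> nat \<Rightarrow> nat" where
  "nat_digit b k i = k div b ^ i mod b"

definition real_digit :: "nat \<Rightarrow> real \<Rightarrow> nat \<Rightarrow> nat" where
  "real_digit b x i = nat (\<lfloor>x * real b ^ i\<rfloor> mod int b)"

text \<open>
  The next results show that \<open>real_digit b x\<close> is the only \<open>b\<close>-adic expansion of \<open>x \<in> [0,1)\<close> with
  infinitely many digits different from \<open>b - 1\<close>.
\<close>

definition badic_expansion :: "nat \<Rightarrow> real \<Rightarrow> (nat \<Rightarrow> nat) \<Rightarrow> bool" where
  "badic_expansion b x c \<longleftrightarrow>
     (\<forall>i\<ge>1. c i < b) \<and> (\<lambda>i. real (c (Suc i)) / real b ^ Suc i) sums x \<and>
     infinite {i. 1 \<le> i \<and> c i \<noteq> b - 1}"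

lemma badic_tail_sums:
  assumes "b \<ge> (2::nat)"
  shows "(\<lambda>i. real (b - 1) / real b ^ Suc i) sums 1"
proof -
  define B where "B = real b"
  have B: "B > 1" using assms by (simp add: B_def)
  have b1: "real (b - 1) = B - 1" using assms by (simp add: B_def of_nat_diff)
  have "(\<lambda>i. (1 / B) ^ i) sums (1 / (1 - 1 / B))"
    by (rule geometric_sums) (use B in simp)
  then have g: "(\<lambda>i. ((B - 1) / B) * (1 / B) ^ i) sums (((B - 1) / B) * (1 / (1 - 1 / B)))"
    by (rule sums_mult)
  have one: "((B - 1) / B) * (1 / (1 - 1 / B)) = 1"
  proof -
    have "1 - 1 / B = (B - 1) / B" using B by (simp add: diff_divide_distrib)
    then show ?thesis using B by simp
  qed
  have tm: "((B - 1) / B) * (1 / B) ^ i = (B - 1) / B ^ Suc i" for i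
    by (simp add: power_one_over inverse_eq_divide)
  show ?thesis
    using g unfolding one tm b1 B_def[symmetric] .
qed

lemma badic_expansion_digit:
  assumes b: "b \<ge> 2" and c: "badic_expansion b x c" and n: "n \<ge> 1"
  shows "c n = real_digit b x n"
proof -
  define S where "S k = (\<Sum>i<k. c (Suc i) * b ^ (k - Suc i))" for k
  have bpos: "real b > 0" using b by simp
  have lt: "c (Suc i) < b" for i using c by (auto simp: badic_expansion_def)
  have sm: "(\<lambda>i. real (c (Suc i)) / real b ^ Suc i) sums x"
    using c by (auto simp: badic_expansion_def)
  have fl: "\<lfloor>x * real b ^ k\<rfloor> = int (S k)" for k
  proof -
    define t where "t i = real (c (Suc (i + k))) / real b ^ Suc i" for i
    define g where "g i = real (b - 1) / real b ^ Suc i" for i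
    have "(\<lambda>i. real (c (Suc (i + k))) / real b ^ Suc (i + k)) sums
        (x - (\<Sum>i<k. real (c (Suc i)) / real b ^ Suc i))"
      using sums_split_initial_segment[OF sm, of k] by simp
    then have scaled: "(\<lambda>i. real (c (Suc (i + k))) / real b ^ Suc (i + k) * real b ^ k) sums
        ((x - (\<Sum>i<k. real (c (Suc i)) / real b ^ Suc i)) * real b ^ k)"
      by (rule sums_mult2)
    have shift: "(\<lambda>i. real (c (Suc (i + k))) / real b ^ Suc (i + k) * real b ^ k) = t"
      using bpos by (simp add: t_def power_add fun_eq_iff)
    have "(\<Sum>i<k. real (c (Suc i)) / real b ^ Suc i) * real b ^ k = real (S k)"
      unfolding S_def of_nat_sum sum_distrib_right
    proof (rule sum.cong)
      fix i assume "i \<in> {..<k}"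
      then have "real b ^ k = real b ^ Suc i * real b ^ (k - Suc i)"
        by (metis Suc_leI add_diff_inverse_nat lessThan_iff not_less power_add)
      then show "real (c (Suc i)) / real b ^ Suc i * real b ^ k
          = real (c (Suc i) * b ^ (k - Suc i))"
        using bpos by simp
    qed simp
    then have head: "(x - (\<Sum>i<k. real (c (Suc i)) / real b ^ Suc i)) * real b ^ k
        = x * real b ^ k - real (S k)"
      by (simp add: left_diff_distrib)
    have ts: "t sums (x * real b ^ k - real (S k))"
      using scaled unfolding shift head .
    have gs: "g sums 1" unfolding g_def by (rule badic_tail_sums[OF b])
    have le: "t i \<le> g i" for i
      using lt[of "i + k"] bpos unfolding t_def g_def
      by (intro divide_right_mono) (auto intro: order.strict_implies_order)
    have "\<exists>j\<ge>k + 1. c j \<noteq> b - 1"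
    proof (rule ccontr)
      assume "\<not> ?thesis"
      then have "{i. 1 \<le> i \<and> c i \<noteq> b - 1} \<subseteq> {..k}" by (auto simp: not_less_eq_eq)
      then have "finite {i. 1 \<le> i \<and> c i \<noteq> b - 1}"
        by (rule finite_subset) simp
      then show False
        using c unfolding badic_expansion_def by blast
    qed
    then obtain j where "j \<ge> k + 1" "c j \<noteq> b - 1" by blast
    then have "c (Suc ((j - k - 1) + k)) \<noteq> b - 1" by simp
    with lt[of "(j - k - 1) + k"] have "c (Suc ((j - k - 1) + k)) < b - 1" by linarith
    then have "t (j - k - 1) < g (j - k - 1)"
      unfolding t_def g_def using bpos by (intro divide_strict_right_mono) auto
    then have "0 < (\<Sum>i. g i - t i)"
      by (intro suminf_pos2[where i = "j - k - 1"])
         (use le sums_summable[OF sums_diff[OF gs ts]] in auto)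
    then have "x * real b ^ k - real (S k) < 1"
      using sums_unique[OF sums_diff[OF gs ts]] by simp
    moreover have "0 \<le> x * real b ^ k - real (S k)"
      by (rule sums_le[OF _ sums_zero ts]) (auto simp: t_def)
    ultimately show ?thesis by (intro floor_unique) auto
  qed
  obtain k where k: "n = Suc k" using n by (cases n) auto
  have "S (Suc k) = c (Suc k) + b * S k"
  proof -
    have "(\<Sum>i<k. c (Suc i) * b ^ (Suc k - Suc i)) = b * S k"
      unfolding S_def sum_distrib_left
    proof (rule sum.cong)
      fix i assume "i \<in> {..<k}"
      then have "Suc k - Suc i = Suc (k - Suc i)" by simp
      then show "c (Suc i) * b ^ (Suc k - Suc i) = b * (c (Suc i) * b ^ (k - Suc i))"
        by (simp only: power_Suc mult.left_commute)
    qed simp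
    then show ?thesis by (simp add: S_def)
  qed
  then have "S n mod b = c n"
    using lt[of k] k by simp
  then show ?thesis
    unfolding real_digit_def fl zmod_int[symmetric] by simp
qed

lemma badic_expansion_real_digit:
  assumes b: "b \<ge> 2" and x: "0 \<le> x" "x < 1"
  shows "badic_expansion b x (real_digit b x)"
proof -
  have bpos: "real b > 0" using b by simp
  have step: "real (real_digit b x (Suc n))
      = of_int \<lfloor>x * real b ^ Suc n\<rfloor> - real b * of_int \<lfloor>x * real b ^ n\<rfloor>" for n
  proof -
    have "\<lfloor>x * real b ^ Suc n / of_int (int b)\<rfloor> = \<lfloor>x * real b ^ Suc n\<rfloor> div int b"
      by (rule floor_divide_real_eq_div) simp
    then have "\<lfloor>x * real b ^ n\<rfloor> = \<lfloor>x * real b ^ Suc n\<rfloor> div int b"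
      using bpos by simp
    then have "\<lfloor>x * real b ^ Suc n\<rfloor> mod int b
        = \<lfloor>x * real b ^ Suc n\<rfloor> - int b * \<lfloor>x * real b ^ n\<rfloor>"
      by (simp only: minus_mult_div_eq_mod)
    moreover have "\<lfloor>x * real b ^ Suc n\<rfloor> mod int b \<ge> 0" using b by simp
    ultimately show ?thesis
      by (simp add: real_digit_def del: power_Suc)
  qed
  have part: "(\<Sum>i<n. real (real_digit b x (Suc i)) / real b ^ Suc i)
      = of_int \<lfloor>x * real b ^ n\<rfloor> / real b ^ n" for n
  proof (induction n)
    case 0
    have "\<lfloor>x\<rfloor> = 0" using x by (simp add: floor_eq_iff)
    then show ?case by simp
  next
    case (Suc n)
    have "A / real b ^ n + (B - real b * A) / real b ^ Suc n = B / real b ^ Suc n" for A B :: real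
      using bpos by (simp add: field_simps)
    then show ?case unfolding sum.lessThan_Suc Suc.IH unfolding step .
  qed
  have err: "x - 1 / real b ^ n \<le> of_int \<lfloor>x * real b ^ n\<rfloor> / real b ^ n"
      "of_int \<lfloor>x * real b ^ n\<rfloor> / real b ^ n \<le> x" for n
  proof -
    have "x * real b ^ n - 1 \<le> of_int \<lfloor>x * real b ^ n\<rfloor>" by linarith
    then show "x - 1 / real b ^ n \<le> of_int \<lfloor>x * real b ^ n\<rfloor> / real b ^ n"
      using bpos by (simp add: le_divide_eq left_diff_distrib)
    show "of_int \<lfloor>x * real b ^ n\<rfloor> / real b ^ n \<le> x"
      using bpos by (simp add: divide_le_eq)
  qed
  have "(\<lambda>n. (1 / real b) ^ n) \<longlonglongrightarrow> 0"
    by (rule LIMSEQ_power_zero) (use b in auto)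
  then have "(\<lambda>n. x - 1 / real b ^ n) \<longlonglongrightarrow> x - 0"
    by (intro tendsto_intros) (simp add: power_divide)
  then have lim: "(\<lambda>n. x - 1 / real b ^ n) \<longlonglongrightarrow> x" by simp
  have "(\<lambda>n. of_int \<lfloor>x * real b ^ n\<rfloor> / real b ^ n) \<longlonglongrightarrow> x"
    by (rule tendsto_sandwich[OF always_eventually always_eventually lim tendsto_const])
       (intro allI err)+
  then have sm: "(\<lambda>i. real (real_digit b x (Suc i)) / real b ^ Suc i) sums x"
    unfolding sums_def part .
  have "infinite {i. 1 \<le> i \<and> real_digit b x i \<noteq> b - 1}"
  proof
    assume "finite {i. 1 \<le> i \<and> real_digit b x i \<noteq> b - 1}"
    then obtain N where N: "{i. 1 \<le> i \<and> real_digit b x i \<noteq> b - 1} \<subseteq> {..N}"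
      using finite_nat_iff_bounded_le by blast
    have all: "real_digit b x (Suc (i + N)) = b - 1" for i
      using N by fastforce
    have "(\<lambda>i. real (real_digit b x (Suc (i + N))) / real b ^ Suc (i + N)) sums
        (x - of_int \<lfloor>x * real b ^ N\<rfloor> / real b ^ N)"
      using sums_split_initial_segment[OF sm, of N] part[of N] by simp
    moreover have "(\<lambda>i. real (real_digit b x (Suc (i + N))) / real b ^ Suc (i + N)) sums
        (1 / real b ^ N)"
      using sums_divide[OF badic_tail_sums[OF b], of "real b ^ N"]
      unfolding all by (simp add: power_add mult_ac)
    ultimately have "x - of_int \<lfloor>x * real b ^ N\<rfloor> / real b ^ N = 1 / real b ^ N"
      using sums_unique2 by blast
    then have "(x - of_int \<lfloor>x * real b ^ N\<rfloor> / real b ^ N) * real b ^ N = 1"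
      using bpos by simp
    then have "x * real b ^ N = of_int \<lfloor>x * real b ^ N\<rfloor> + 1"
      using bpos by (simp add: left_diff_distrib)
    then show False by linarith
  qed
  moreover have "real_digit b x i < b" for i
    using b by (simp add: real_digit_def nat_less_iff)
  ultimately show ?thesis using sm by (simp add: badic_expansion_def)
qed

subsection \<open>Walsh functions and Walsh coefficients\<close>

definition unit_cube :: "nat \<Rightarrow> (nat \<Rightarrow> real) set" where
  "unit_cube n = {1..n} \<rightarrow>\<^sub>E {0..<1}"

definition cube_measure :: "nat \<Rightarrow> (nat \<Rightarrow> real) measure" where
  "cube_measure n = (\<Pi>\<^sub>M j\<in>{1..n}. restrict_space lborel {0..<1})"

text \<open>The digits of \<open>k\<close> at positions \<open>i\<close> with \<open>b ^ i > k\<close> vanish.\<close>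

definition wal :: "nat \<Rightarrow> nat \<Rightarrow> real \<Rightarrow> complex" where
  "wal b k x = exp (2 * pi * \<i> / b) ^ (\<Sum>i | b ^ i \<le> k. real_digit b x (i + 1) * nat_digit b k i)"

definition wal_vec :: "nat \<Rightarrow> nat \<Rightarrow> (nat \<Rightarrow> nat) \<Rightarrow> (nat \<Rightarrow> real) \<Rightarrow> complex" where
  "wal_vec b s l x = (\<Prod>j\<in>{1..s}. wal b (l j) (x j))"

definition walsh_coeff :: "nat \<Rightarrow> nat \<Rightarrow> ((nat \<Rightarrow> real) \<Rightarrow> real) \<Rightarrow> (nat \<Rightarrow> nat) \<Rightarrow> complex" where
  "walsh_coeff b s f l =
     (LINT x|cube_measure s. complex_of_real (f x) * cnj (wal_vec b s l x))"

text \<open>\<open>pad n u k\<close> is the vector \<open>(k\<^sub>u, 0)\<close> of length \<open>n\<close>.\<close>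

definition pad :: "nat \<Rightarrow> nat set \<Rightarrow> (nat \<Rightarrow> nat) \<Rightarrow> nat \<Rightarrow> nat" where
  "pad n u k = (\<lambda>j\<in>{1..n}. if j \<in> u then k j else 0)"

subsection \<open>The decay functions\<close>

text \<open>The sum of the \<open>\<alpha>\<close> largest (or of all, if fewer) positions \<open>a\<close> with non-zero digit of \<open>b^(a-1)\<close>.\<close>

definition mu :: "nat \<Rightarrow> nat \<Rightarrow> nat \<Rightarrow> nat" where
  "mu b \<alpha> k =
     sum_list (take \<alpha> (rev (sorted_list_of_set {a. 1 \<le> a \<and> nat_digit b k (a - 1) \<noteq> 0})))"

definition r_decay :: "nat \<Rightarrow> nat \<Rightarrow> nat \<Rightarrow> real" where
  "r_decay b \<alpha> k = real b powr (- real (mu b \<alpha> k))"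

definition r_tilde :: "nat \<Rightarrow> nat \<Rightarrow> nat \<Rightarrow> nat \<Rightarrow> real" where
  "r_tilde b \<alpha> d k =
     (if k = 0 then 1 else real b powr (- real (min \<alpha> d) * real (mu b 1 k) - real \<alpha> / 2))"

subsection \<open>The weighted Walsh space and the worst-case error\<close>

definition walsh_norm ::
    "nat \<Rightarrow> nat \<Rightarrow> nat \<Rightarrow> (nat set \<Rightarrow> real) \<Rightarrow> ((nat \<Rightarrow> real) \<Rightarrow> real) \<Rightarrow> ennreal" where
  "walsh_norm b s \<alpha> \<gamma> f =
     (SUP v\<in>{v. v \<subseteq> {1..s} \<and> \<gamma> v \<noteq> 0}. ennreal (inverse (\<gamma> v)) *
        (SUP l\<in>(v \<rightarrow>\<^sub>E {1..}).
           ennreal (cmod (walsh_coeff b s f (pad s v l)) / (\<Prod>j\<in>v. r_decay b \<alpha> (l j)))))"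

text \<open>
  The norm skips the \<open>v\<close> with \<open>\<gamma> v = 0\<close>. As usual for weighted spaces (\<open>c / 0 = \<infinity>\<close> for \<open>c > 0\<close> and
  \<open>0 / 0 = 0\<close>), the corresponding Walsh coefficients of the members of the space vanish;
  without this the norm would only be a seminorm with a non-trivial kernel.
\<close>

definition walsh_space ::
    "nat \<Rightarrow> nat \<Rightarrow> nat \<Rightarrow> (nat set \<Rightarrow> real) \<Rightarrow> ((nat \<Rightarrow> real) \<Rightarrow> real) set" where
  "walsh_space b s \<alpha> \<gamma> =
     {f. f \<in> borel_measurable (cube_measure s) \<and> integrable (cube_measure s) (\<lambda>x. (f x)\<^sup>2) \<and>
         walsh_norm b s \<alpha> \<gamma> f < \<infinity> \<and>
         (\<forall>v. v \<subseteq> {1..s} \<and> \<gamma> v = 0 \<longrightarrow> (\<forall>l\<in>(v \<rightarrow>\<^sub>E {1..}). walsh_coeff b s f (pad s v l) = 0)) \<and>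
         (\<forall>x\<in>unit_cube s.
            (\<lambda>l. cmod (walsh_coeff b s f l * wal_vec b s l x)) summable_on ({1..s} \<rightarrow>\<^sub>E UNIV) \<and>
            ((\<lambda>l. walsh_coeff b s f l * wal_vec b s l x) has_sum complex_of_real (f x))
              ({1..s} \<rightarrow>\<^sub>E UNIV))}"

text \<open>Point sets are indexed families \<open>x\<^sub>0, \<dots>, x\<^sub>N\<^sub>-\<^sub>1\<close>, so points are counted with multiplicity.\<close>

definition worst_case_error ::
    "nat \<Rightarrow> nat \<Rightarrow> nat \<Rightarrow> (nat set \<Rightarrow> real) \<Rightarrow> nat \<Rightarrow> (nat \<Rightarrow> nat \<Rightarrow> real) \<Rightarrow> ennreal" where
  "worst_case_error b s \<alpha> \<gamma> N x =
     (SUP f\<in>{f \<in> walsh_space b s \<alpha> \<gamma>. walsh_norm b s \<alpha> \<gamma> f \<le> 1}.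
        ennreal \<bar>1 / real N * (\<Sum>n<N. f (x n)) - (LINT x|cube_measure s. f x)\<bar>)"

subsection \<open>Polynomial lattices and their duals\<close>

definition nat_poly :: "nat \<Rightarrow> 'b::prime_card mod_ring poly" where
  "nat_poly n = (\<Sum>i | CARD('b) ^ i \<le> n. Polynomial.monom (of_nat (nat_digit CARD('b) n i)) i)"

definition tr_poly :: "nat \<Rightarrow> nat \<Rightarrow> 'b::prime_card mod_ring poly" where
  "tr_poly m k = (\<Sum>i<m. Polynomial.monom (of_nat (nat_digit CARD('b) k i)) i)"

text \<open>
  Polynomials as Laurent series in \<open>x^(-1)\<close>: the variable of \<^typ>\<open>'a fls\<close> stands for \<open>x^(-1)\<close>,
  so that \<open>x\<close> becomes \<^term>\<open>fls_X_inv\<close> and \<open>fls_nth g l\<close> is the coefficient of \<open>x^(-l)\<close>.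
\<close>

definition laurent :: "'a::field poly \<Rightarrow> 'a fls" where
  "laurent g = (\<Sum>i\<le>Polynomial.degree g. fls_const (Polynomial.coeff g i) * fls_X_inv ^ i)"

text \<open>Coefficients below the order \<open>w\<close> of the series vanish, so the sum may start at \<open>l = 1\<close>.\<close>

definition v_trunc :: "nat \<Rightarrow> 'b::prime_card mod_ring fls \<Rightarrow> real" where
  "v_trunc m g = (\<Sum>l=1..m. real_of_int (to_int_mod_ring (fls_nth g (int l))) / real CARD('b) ^ l)"

definition lattice_point ::
    "nat \<Rightarrow> nat \<Rightarrow> (nat \<Rightarrow> 'b::prime_card mod_ring poly) \<Rightarrow> 'b mod_ring poly \<Rightarrow> nat \<Rightarrow> nat \<Rightarrow> real"
  where
  "lattice_point m t q p n =
     (\<lambda>j\<in>{1..t}. v_trunc m (laurent (nat_poly n * q j) / laurent p))"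

definition dual_lattice ::
    "nat \<Rightarrow> nat \<Rightarrow> (nat \<Rightarrow> 'b::prime_card mod_ring poly) \<Rightarrow> 'b mod_ring poly \<Rightarrow> (nat \<Rightarrow> nat) set"
  where
  "dual_lattice m t q p =
     {k \<in> {1..t} \<rightarrow>\<^sub>E UNIV. [(\<Sum>j=1..t. tr_poly m (k j) * q j) = 0] (mod p)}"

subsection \<open>Interlacing\<close>

definition interlace :: "nat \<Rightarrow> nat \<Rightarrow> (nat \<Rightarrow> real) \<Rightarrow> real" where
  "interlace b d y =
     (\<Sum>a. \<Sum>r=1..d. real (real_digit b (y r) (Suc a)) / real b ^ (r + a * d))"

definition interlace_vec :: "nat \<Rightarrow> nat \<Rightarrow> nat \<Rightarrow> (nat \<Rightarrow> real) \<Rightarrow> nat \<Rightarrow> real" where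
  "interlace_vec b d s z = (\<lambda>j\<in>{1..s}. interlace b d (\<lambda>r. z ((j - 1) * d + r)))"

text \<open>The set \<open>w(u)\<close> of blocks met by \<open>u\<close>.\<close>

definition blocks :: "nat \<Rightarrow> nat \<Rightarrow> nat set \<Rightarrow> nat set" where
  "blocks d s u = {j \<in> {1..s}. u \<inter> {(j - 1) * d + 1..j * d} \<noteq> {}}"

definition weight_tilde :: "nat \<Rightarrow> nat \<Rightarrow> nat \<Rightarrow> (nat set \<Rightarrow> real) \<Rightarrow> nat set \<Rightarrow> real" where
  "weight_tilde b d \<alpha> \<gamma> v =
     \<gamma> v * real b powr (real \<alpha> * (2 * real d - 1) * real (card v) / 2)"

end

theory Submission
  imports Defs
begin

text \<open>
  Digit interlacing of points is dual to digit interlacing of frequencies: the Walsh function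
  \<open>wal\<^sub>l\<close> at an interlaced point equals \<open>wal\<^sub>k\<close> at the original point, where \<open>k\<close> is obtained from
  \<open>l\<close> by deinterlacing its digits. Averaged over the lattice points, \<open>wal\<^sub>k\<close> is a character sum
  over the polynomials of degree below \<open>m\<close> and vanishes unless \<open>k\<close> lies in the dual lattice. So only
  Walsh coefficients with \<open>k\<close> in the dual lattice contribute to the error. They are bounded by
  \<open>r\<^sub>\<alpha>(l)\<close>, and comparing the \<open>\<alpha>\<close> leading digit positions of one component \<open>l\<^sub>j\<close> with the
  leading positions of its \<open>d\<close> deinterlaced parts costs the factor \<open>b^(\<alpha>(2d-1)/2)\<close>.
\<close>

text \<open>Division with remainder by \<open>k\<close> on the index set. Placed in
  \<open>comm_monoid_set\<close> because it is needed for sums over digit positions and for sums and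
  products over the \<open>d * s\<close> components.\<close>

lemma (in comm_monoid_set) nat_blocks:
  fixes g :: "nat \<Rightarrow> 'a"
  shows "F g {..<n * k} = F (\<lambda>m. F (\<lambda>r. g (m * k + r)) {..<k}) {..<n}"
proof -
  have "F g {m * k..<m * k + k} = F (\<lambda>r. g (m * k + r)) {..<k}" for m
    using shift_bounds_nat_ivl[of g 0 "m * k" k] by (simp add: atLeast0LessThan add.commute)
  then show ?thesis unfolding nat_group[symmetric] by simp
qed

subsection \<open>Digits of natural numbers\<close>

lemma nat_digit_less: "b \<ge> 1 \<Longrightarrow> nat_digit b k i < b"
  by (simp add: nat_digit_def)

lemma nat_digit_zero [simp]: "nat_digit b 0 i = 0"
  by (simp add: nat_digit_def)

lemma nat_digit_eq_0: "k < b ^ i \<Longrightarrow> nat_digit b k i = 0"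
  by (simp add: nat_digit_def)

lemma nat_digit_eq_0_self: "b \<ge> 2 \<Longrightarrow> k \<le> i \<Longrightarrow> nat_digit b k i = 0"
  by (intro nat_digit_eq_0 le_less_trans[OF _ power_gt_expt]) auto

lemma nat_digit_Suc: "nat_digit b k (Suc i) = nat_digit b (k div b) i"
  by (simp add: nat_digit_def div_mult2_eq)

lemma nat_digit_nonzero_ex: "b \<ge> 2 \<Longrightarrow> k \<noteq> 0 \<Longrightarrow> \<exists>i. nat_digit b k i \<noteq> 0"
proof (induction k rule: less_induct)
  case (less k)
  show ?case
  proof (cases "k mod b = 0")
    case True
    then have "k div b < k" "k div b \<noteq> 0" using less.prems by auto
    then obtain i where "nat_digit b (k div b) i \<noteq> 0" using less.IH less.prems by blast
    then have "nat_digit b k (Suc i) \<noteq> 0" by (simp add: nat_digit_Suc)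
    then show ?thesis by blast
  next
    case False
    then have "nat_digit b k 0 \<noteq> 0" by (simp add: nat_digit_def)
    then show ?thesis by blast
  qed
qed

text \<open>Division by \<open>b\<close> drops digit 0 and shifts the others, which drives a strong
  induction. This gives injectivity of both \<open>nat_poly\<close> and deinterlacing.\<close>

lemma nat_digit_inject:
  assumes b: "b \<ge> 2" and "\<And>i. nat_digit b k i = nat_digit b k' i"
  shows "k = k'"
  using assms(2)
proof (induction k arbitrary: k' rule: less_induct)
  case (less k)
  show ?case
  proof (cases "k = 0")
    case True
    then have "\<not> (\<exists>i. nat_digit b k' i \<noteq> 0)" using less.prems by simp
    then have "k' = 0" using nat_digit_nonzero_ex[OF b] by blast
    then show ?thesis using True by simp
  next
    case False
    then have "k div b < k" using b by simp
    moreover have "nat_digit b (k div b) i = nat_digit b (k' div b) i" for i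
      using less.prems[of "Suc i"] by (simp add: nat_digit_Suc)
    ultimately have "k div b = k' div b" by (rule less.IH)
    moreover have "k mod b = k' mod b" using less.prems[of 0] by (simp add: nat_digit_def)
    ultimately show ?thesis by (metis div_mult_mod_eq)
  qed
qed

text \<open>The induction peels off the lowest digit; \<open>c\<close> is kept arbitrary because the
  rest uses the shifted sequence.\<close>

lemma nat_digit_sum:
  assumes b: "b \<ge> 2" and c: "\<And>i. i < L \<Longrightarrow> c i < b"
  shows "nat_digit b (\<Sum>i<L. c i * b ^ i) a = (if a < L then c a else 0)"
  using c
proof (induction L arbitrary: c a)
  case 0
  then show ?case by simp
next
  case (Suc L)
  define n where "n = (\<Sum>i<L. c (Suc i) * b ^ i)"
  have split: "(\<Sum>i<Suc L. c i * b ^ i) = c 0 + b * n"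
    unfolding n_def sum.lessThan_Suc_shift sum_distrib_left by (simp add: mult_ac)
  have n: "nat_digit b n i = (if i < L then c (Suc i) else 0)" for i
    unfolding n_def by (rule Suc.IH) (use Suc.prems in auto)
  have c0: "c 0 < b" using Suc.prems by auto
  show ?case
  proof (cases a)
    case 0
    then show ?thesis unfolding split using c0 by (simp add: nat_digit_def)
  next
    case (Suc i)
    have "(c 0 + b * n) div b = n" using c0 by simp
    then show ?thesis unfolding split Suc nat_digit_Suc using n by simp
  qed
qed

lemma sum_digits_less:
  assumes b: "b \<ge> (2::nat)" and c: "\<And>i. i < L \<Longrightarrow> c i < b"
  shows "(\<Sum>i<L. c i * b ^ i) < b ^ L"
  using c
proof (induction L)
  case (Suc L)
  have "c L * b ^ L \<le> (b - 1) * b ^ L" using Suc.prems[of L] by (intro mult_right_mono) auto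
  moreover have "b ^ L + (b - 1) * b ^ L = b ^ Suc L" using b by (cases b) auto
  moreover have "(\<Sum>i<L. c i * b ^ i) < b ^ L" using Suc by simp
  ultimately show ?case unfolding sum.lessThan_Suc by linarith
qed simp

subsection \<open>Reals with finitely many digits\<close>

lemma finite_expansion_less_1:
  assumes b: "b \<ge> (2::nat)" and c: "\<And>i. c i < b"
  shows "(\<Sum>i<M. real (c i) / real b ^ Suc i) < 1"
proof -
  \<comment> \<open>The strict bound does not carry an induction; this one does, being the value for
    all digits equal to \<open>b - 1\<close>.\<close>
  have "(\<Sum>i<M. real (c i) / real b ^ Suc i) \<le> 1 - 1 / real b ^ M"
  proof (induction M)
    case (Suc M)
    have "real (c M) \<le> real b - 1" using c[of M] by linarith
    then have "real (c M) / real b ^ Suc M \<le> (real b - 1) / real b ^ Suc M"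
      by (intro divide_right_mono) auto
    also have "\<dots> = 1 / real b ^ M - 1 / real b ^ Suc M"
      using b by (simp add: field_simps)
    finally show ?case using Suc by simp
  qed simp
  moreover have "1 / real b ^ M > 0" using b by simp
  ultimately show ?thesis by linarith
qed

text \<open>Padded with zeros, the finite sequence has infinitely many digits different from
  \<open>b - 1\<close>, since \<open>b \<ge> 2\<close>. Uniqueness of such expansions then
  identifies the digits.\<close>

lemma real_digit_finite_expansion:
  assumes b: "b \<ge> 2" and c: "\<And>i. c i < b"
  shows "real_digit b (\<Sum>i<M. real (c i) / real b ^ Suc i) (Suc i) = (if i < M then c i else 0)"
proof -
  define c' where "c' i = (if i \<ge> 1 \<and> i \<le> M then c (i - 1) else 0)" for i
  have "(\<lambda>i. real (c' (Suc i)) / real b ^ Suc i) sums (\<Sum>i<M. real (c' (Suc i)) / real b ^ Suc i)"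
    by (rule sums_finite) (auto simp: c'_def)
  also have "(\<Sum>i<M. real (c' (Suc i)) / real b ^ Suc i) = (\<Sum>i<M. real (c i) / real b ^ Suc i)"
    by (intro sum.cong) (auto simp: c'_def)
  finally have s: "(\<lambda>i. real (c' (Suc i)) / real b ^ Suc i) sums (\<Sum>i<M. real (c i) / real b ^ Suc i)" .
  have "infinite {i. 1 \<le> i \<and> c' i \<noteq> b - 1}"
  proof
    assume "finite {i. 1 \<le> i \<and> c' i \<noteq> b - 1}"
    moreover have "{M<..} \<subseteq> {i. 1 \<le> i \<and> c' i \<noteq> b - 1}" using b by (auto simp: c'_def)
    ultimately show False using finite_subset infinite_Ioi by blast
  qed
  then have "badic_expansion b (\<Sum>i<M. real (c i) / real b ^ Suc i) c'"
    using s b c by (auto simp: badic_expansion_def c'_def)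
  from badic_expansion_digit[OF b this, of "Suc i"] show ?thesis
    by (auto simp: c'_def)
qed

text \<open>With only \<open>m\<close> digits per component the interlacing series is finite.
  Counting from 0, its position \<open>i\<close> holds digit \<open>i div d\<close> of component
  \<open>i mod d\<close>.\<close>

lemma interlace_finite_expansion:
  assumes d: "d \<ge> 1"
    and y: "\<And>r a. r < d \<Longrightarrow> real_digit b (y (Suc r)) (Suc a) = (if a < m then c a r else 0)"
  shows "interlace b d y = (\<Sum>i<m * d. real (c (i div d) (i mod d)) / real b ^ Suc i)"
proof -
  have inner: "(\<Sum>r=1..d. real (real_digit b (y r) (Suc a)) / real b ^ (r + a * d))
      = (if a < m then \<Sum>r<d. real (c a r) / real b ^ Suc (a * d + r) else 0)" for a
    unfolding One_nat_def sum.atLeast1_atMost_eq using y by (simp add: add.commute)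
  have "interlace b d y = (\<Sum>a<m. \<Sum>r<d. real (c a r) / real b ^ Suc (a * d + r))"
    unfolding interlace_def inner by (subst suminf_finite[of "{..<m}"]) auto
  also have "\<dots> = (\<Sum>i<m * d. real (c (i div d) (i mod d)) / real b ^ Suc i)"
    unfolding sum.nat_blocks by (intro sum.cong refl) simp
  finally show ?thesis .
qed

subsection \<open>Walsh functions\<close>

text \<open>Makes the range of the exponent independent of \<open>k\<close>: both ranges are
  extended to their union, and in each added term one of the two digits is 0.\<close>

lemma wal_finite_expansion:
  assumes b: "b \<ge> 2" and x: "\<And>i. i \<ge> M \<Longrightarrow> real_digit b x (Suc i) = 0"
  shows "wal b k x = exp (2 * pi * \<i> / b) ^ (\<Sum>i<M. real_digit b x (Suc i) * nat_digit b k i)"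
proof -
  have fin: "finite {i. b ^ i \<le> k}"
  proof (rule finite_subset)
    have "i \<le> k" if "b ^ i \<le> k" for i
    proof -
      have "i < b ^ i" by (rule power_gt_expt) (use b in simp)
      with that show ?thesis by simp
    qed
    then show "{i. b ^ i \<le> k} \<subseteq> {..k}" by auto
  qed simp
  have "(\<Sum>i | b ^ i \<le> k. real_digit b x (i + 1) * nat_digit b k i)
      = (\<Sum>i\<in>{i. b ^ i \<le> k} \<union> {..<M}. real_digit b x (i + 1) * nat_digit b k i)"
    by (rule sum.mono_neutral_left) (simp_all add: fin nat_digit_eq_0 not_le)
  also have "\<dots> = (\<Sum>i<M. real_digit b x (Suc i) * nat_digit b k i)"
    by (rule sum.mono_neutral_cong_right) (simp_all add: fin x not_less)
  finally show ?thesis by (simp add: wal_def)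
qed

lemma wal_0 [simp]: "b \<ge> 2 \<Longrightarrow> wal b 0 x = 1"
  by (simp add: wal_def)

lemma norm_wal [simp]: "cmod (wal b k x) = 1"
proof -
  have "cmod (exp (2 * pi * \<i> / b)) = 1" by (simp add: norm_exp_eq_Re)
  then show ?thesis by (simp only: wal_def norm_power power_one)
qed

subsection \<open>Polynomials as Laurent series\<close>

lemma fls_nth_sum: "fls_nth (\<Sum>i\<in>A. f i) k = (\<Sum>i\<in>A. fls_nth (f i) k)"
  by (induction A rule: infinite_finite_induct) auto

lemma laurent_nth:
  "fls_nth (laurent g) k = (if k \<le> 0 then Polynomial.coeff g (nat (- k)) else 0)"
proof -
  have "fls_nth (laurent g) k
      = (\<Sum>i\<le>Polynomial.degree g. if k = - int i then Polynomial.coeff g i else 0)"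
    unfolding laurent_def fls_nth_sum by (intro sum.cong) auto
  also have "\<dots> = (\<Sum>i\<le>Polynomial.degree g. if i = nat (- k) then (if k \<le> 0 then Polynomial.coeff g (nat (- k)) else 0) else 0)"
    by (intro sum.cong) auto
  also have "\<dots> = (if k \<le> 0 then Polynomial.coeff g (nat (- k)) else 0)"
    by (auto simp: coeff_eq_0)
  finally show ?thesis .
qed

lemma laurent_0 [simp]: "laurent 0 = 0"
  by (rule fls_eqI) (simp add: laurent_nth)

lemma laurent_add: "laurent (f + g) = laurent f + laurent g"
  by (rule fls_eqI) (simp add: laurent_nth)

lemma laurent_sum: "laurent (\<Sum>i\<in>A. f i) = (\<Sum>i\<in>A. laurent (f i))"
  by (induction A rule: infinite_finite_induct) (auto simp: laurent_add)

lemma laurent_smult: "laurent (Polynomial.smult c g) = fls_const c * laurent g"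
  by (rule fls_eqI) (simp add: laurent_nth)

lemma laurent_pCons: "laurent (pCons c g) = fls_const c + fls_X_inv * laurent g"
proof (rule fls_eqI)
  fix k :: int
  have "nat (- k) = Suc (nat (- (k + 1)))" if "k < 0" using that by simp
  then show "fls_nth (laurent (pCons c g)) k = fls_nth (fls_const c + fls_X_inv * laurent g) k"
    by (cases "k < 0") (auto simp: laurent_nth fls_X_inv_times_conv_shift)
qed

text \<open>Induction along the Horner form of \<open>f\<close>, where \<open>pCons\<close> becomes
  multiplication by \<open>fls_X_inv\<close>.\<close>

lemma laurent_mult: "laurent (f * g) = laurent f * laurent g"
proof (induction f)
  case (pCons c f)
  have "laurent (pCons c f * g) = fls_const c * laurent g + fls_X_inv * laurent (f * g)"
    using laurent_pCons[of 0 "f * g"] by (simp add: laurent_add laurent_smult)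
  then show ?case using pCons.IH by (simp add: laurent_pCons algebra_simps)
qed simp

lemma laurent_monom: "laurent (Polynomial.monom c i) = fls_const c * fls_X_inv ^ i"
  by (rule fls_eqI) (auto simp: laurent_nth)

lemma laurent_eq_0_iff [simp]: "laurent g = 0 \<longleftrightarrow> g = 0"
proof
  assume "laurent g = 0"
  then have "Polynomial.coeff g i = 0" for i using laurent_nth[of g "- int i"] by simp
  then show "g = 0" by (simp add: poly_eq_iff)
qed simp

lemma subdegree_laurent: "g \<noteq> 0 \<Longrightarrow> fls_subdegree (laurent g) = - int (Polynomial.degree g)"
  by (rule fls_subdegree_eqI) (auto simp: laurent_nth coeff_eq_0)

text \<open>The shift of the remainder of \<open>g\<close> to degree \<open>m - 1\<close> turns its leading coefficient into a residue.\<close>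

lemma nonzero_residue:
  fixes p g :: "'a::field poly"
  assumes m: "Polynomial.degree p = m" and g: "\<not> p dvd g" and p: "p \<noteq> 0"
  obtains e where "e < m" "fls_nth (laurent (Polynomial.monom 1 e * g) / laurent p) 1 \<noteq> 0"
proof -
  define r where "r = g mod p"
  have r: "r \<noteq> 0" using g by (simp add: r_def dvd_eq_mod_eq_0)
  then have deg: "Polynomial.degree r < m"
    using degree_mod_less[OF p, of g] m by (simp add: r_def)
  define e where "e = m - 1 - Polynomial.degree r"
  define f where "f = Polynomial.monom (1 :: 'a) e"
  have f: "f \<noteq> 0" "Polynomial.degree f = e" by (auto simp: f_def degree_monom_eq)
  have lp: "laurent p \<noteq> 0" using p by simp
  \<comment> \<open>After division by \<open>p\<close> the first summand is a polynomial and has no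
    coefficient at x^(-1), so only the remainder matters.\<close>
  have "f * g = p * (f * (g div p)) + f * r"
    unfolding r_def by (metis distrib_left mult.left_commute mult_div_mod_eq)
  then have "laurent (f * g) / laurent p = laurent (f * (g div p)) + laurent (f * r) / laurent p"
    using lp by (simp add: laurent_add laurent_mult add_divide_distrib)
  then have eq: "fls_nth (laurent (f * g) / laurent p) 1 = fls_nth (laurent (f * r) / laurent p) 1"
    by (simp add: laurent_nth)
  have "Polynomial.degree (f * r) = m - 1"
    using f r deg by (simp add: degree_mult_eq e_def)
  then have "fls_subdegree (laurent (f * r) / laurent p) = 1"
    using f r lp deg p by (subst fls_divide_subdegree) (auto simp: subdegree_laurent m)
  moreover have "laurent (f * r) / laurent p \<noteq> 0" using f r lp by simp
  ultimately have "fls_nth (laurent (f * r) / laurent p) 1 \<noteq> 0"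
    by (metis nth_fls_subdegree_nonzero)
  then show ?thesis using that[of e] deg eq unfolding f_def e_def by simp
qed

subsection \<open>Character sums\<close>

text \<open>The standard non-trivial additive character of the field with \<open>b\<close>
  elements.\<close>

definition char_mod_ring :: "'b::prime_card mod_ring \<Rightarrow> complex" where
  "char_mod_ring z = exp (2 * pi * \<i> / CARD('b)) ^ nat (to_int_mod_ring z)"

lemma root_of_unity_power_eq_1_iff:
  "n \<ge> 1 \<Longrightarrow> exp (2 * pi * \<i> / of_nat n) ^ j = 1 \<longleftrightarrow> n dvd j"
  using complex_root_unity_eq_1[of n j] by (simp add: exp_of_nat_mult[symmetric] mult_ac)

text \<open>Powers of a \<open>b\<close>-th root of unity depend on the exponent modulo
  \<open>b\<close> only. Hence the natural number in the exponent of a Walsh function may be read as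
  a field element.\<close>

lemma char_mod_ring_of_nat:
  "char_mod_ring (of_nat j :: 'b::prime_card mod_ring) = exp (2 * pi * \<i> / CARD('b)) ^ j"
proof -
  define w where "w = exp (2 * pi * \<i> / CARD('b))"
  have w: "w ^ CARD('b) = 1"
    unfolding w_def by (subst root_of_unity_power_eq_1_iff) auto
  have "to_int_mod_ring (of_nat j :: 'b mod_ring) = int (j mod CARD('b))"
    by (simp add: of_nat_of_int_mod_ring of_int_mod_ring.rep_eq to_int_mod_ring.rep_eq zmod_int)
  then have "char_mod_ring (of_nat j :: 'b mod_ring) = w ^ (j mod CARD('b))"
    by (simp add: char_mod_ring_def w_def)
  also have "\<dots> = w ^ (CARD('b) * (j div CARD('b)) + j mod CARD('b))"
    by (simp only: power_add power_mult w power_one mult_1)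
  finally show ?thesis by (simp add: w_def)
qed

lemma char_mod_ring_add: "char_mod_ring (x + y) = char_mod_ring x * char_mod_ring y"
proof -
  obtain i j where "x = of_nat i" "y = of_nat j" using surj_of_nat_mod_ring by meson
  then show ?thesis by (simp add: char_mod_ring_of_nat power_add flip: of_nat_add)
qed

lemma char_mod_ring_eq_1_iff: "char_mod_ring x = 1 \<longleftrightarrow> x = 0"
proof -
  obtain i where x: "x = of_nat i" "i < CARD('a)" using surj_of_nat_mod_ring[of x] by auto
  have "char_mod_ring x = 1 \<longleftrightarrow> CARD('a) dvd i"
    unfolding x char_mod_ring_of_nat by (rule root_of_unity_power_eq_1_iff) simp
  also have "\<dots> \<longleftrightarrow> x = 0"
    using x by (auto simp: of_nat_0_mod_ring_dvd dest: dvd_imp_le)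
  finally show ?thesis .
qed

section \<open>Natural numbers as polynomials over the finite field\<close>

lemma CARD_prime_card_ge_2: "CARD('b::prime_card) \<ge> 2"
  using prime_card[where 'a = 'b] prime_ge_2_nat by blast

lemma coeff_nat_poly:
  "Polynomial.coeff (nat_poly n :: 'b::prime_card mod_ring poly) i = of_nat (nat_digit CARD('b) n i)"
proof -
  have "finite {i. CARD('b) ^ i \<le> n}"
  proof (rule finite_subset)
    have "i \<le> n" if "CARD('b) ^ i \<le> n" for i
    proof -
      have "Suc 0 < CARD('b)" using CARD_prime_card_ge_2[where 'b = 'b] by linarith
      then have "i < CARD('b) ^ i" by (rule power_gt_expt)
      with that show ?thesis by simp
    qed
    then show "{i. CARD('b) ^ i \<le> n} \<subseteq> {..n}" by auto
  qed simp
  then show ?thesis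
    by (simp add: nat_poly_def coeff_sum nat_digit_eq_0)
qed

lemma of_nat_mod_ring_inject:
  assumes "i < CARD('b)" "j < CARD('b)" "(of_nat i :: 'b::prime_card mod_ring) = of_nat j"
  shows "i = j"
proof -
  have "to_int_mod_ring (of_nat i :: 'b mod_ring) = int i" "to_int_mod_ring (of_nat j :: 'b mod_ring) = int j"
    using assms(1,2) by (simp_all add: of_nat_of_int_mod_ring)
  then have "int i = int j" using assms(3) by argo
  then show ?thesis by (simp only: of_nat_eq_iff)
qed

text \<open>Turns the sum over point indices into a sum over an additive group. Degree below
  \<open>m\<close> is expressed by vanishing coefficients, which makes closure under addition
  immediate.\<close>

lemma bij_betw_nat_poly:
  "bij_betw nat_poly {..<CARD('b) ^ m} {h :: 'b::prime_card mod_ring poly. \<forall>i\<ge>m. Polynomial.coeff h i = 0}"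
proof -
  note b = CARD_prime_card_ge_2[where 'b = 'b]
  have inj: "inj (nat_poly :: nat \<Rightarrow> 'b mod_ring poly)"
  proof (rule injI)
    fix n n' assume "(nat_poly n :: 'b mod_ring poly) = nat_poly n'"
    then have "(of_nat (nat_digit CARD('b) n i) :: 'b mod_ring) = of_nat (nat_digit CARD('b) n' i)" for i
      by (metis coeff_nat_poly)
    then have "nat_digit CARD('b) n i = nat_digit CARD('b) n' i" for i
      by (intro of_nat_mod_ring_inject) (auto intro: nat_digit_less)
    then show "n = n'" by (rule nat_digit_inject[OF b])
  qed
  moreover have "nat_poly ` {..<CARD('b) ^ m} = {h :: 'b mod_ring poly. \<forall>i\<ge>m. Polynomial.coeff h i = 0}"
  proof (intro equalityI subsetI)
    fix h :: "'b mod_ring poly" assume "h \<in> nat_poly ` {..<CARD('b) ^ m}"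
    then obtain n where n: "n < CARD('b) ^ m" "h = nat_poly n" by auto
    have "nat_digit CARD('b) n i = 0" if "i \<ge> m" for i
    proof (rule nat_digit_eq_0)
      have "CARD('b) ^ m \<le> CARD('b) ^ i" using that b by (intro power_increasing) auto
      with n(1) show "n < CARD('b) ^ i" by simp
    qed
    then show "h \<in> {h. \<forall>i\<ge>m. Polynomial.coeff h i = 0}" by (simp add: n(2) coeff_nat_poly)
  next
    fix h :: "'b mod_ring poly" assume h: "h \<in> {h. \<forall>i\<ge>m. Polynomial.coeff h i = 0}"
    have "\<forall>i. \<exists>c<CARD('b). Polynomial.coeff h i = of_nat c" using surj_of_nat_mod_ring by blast
    then obtain c where c: "\<And>i. c i < CARD('b)" "\<And>i. Polynomial.coeff h i = of_nat (c i)" by metis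
    define n where "n = (\<Sum>i<m. c i * CARD('b) ^ i)"
    have dig: "nat_digit CARD('b) n i = (if i < m then c i else 0)" for i
      unfolding n_def using b c by (intro nat_digit_sum) auto
    have "h = nat_poly n"
      by (rule poly_eqI) (use h in \<open>auto simp: coeff_nat_poly dig c(2)[symmetric]\<close>)
    moreover have "n < CARD('b) ^ m" unfolding n_def using b c by (intro sum_digits_less) auto
    ultimately show "h \<in> nat_poly ` {..<CARD('b) ^ m}" by auto
  qed
  ultimately show ?thesis
    by (auto simp: bij_betw_def intro: inj_on_subset)
qed

text \<open>Orthogonality of characters: translation by some \<open>h0\<close> with
  \<open>\<phi> h0 \<noteq> 1\<close> permutes the group but multiplies the sum by
  \<open>\<phi> h0\<close>.\<close>

lemma char_sum_eq_0:
  fixes p g :: "'b::prime_card mod_ring poly"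
  assumes m: "Polynomial.degree p = m" and p: "p \<noteq> 0" and g: "\<not> p dvd g"
  shows "(\<Sum>n<CARD('b) ^ m. char_mod_ring (fls_nth (laurent (nat_poly n * g) / laurent p) 1)) = 0"
proof -
  define H where "H = {h :: 'b mod_ring poly. \<forall>i\<ge>m. Polynomial.coeff h i = 0}"
  define \<phi> where "\<phi> h = char_mod_ring (fls_nth (laurent (h * g) / laurent p) 1)" for h
  have add: "\<phi> (h + h') = \<phi> h * \<phi> h'" for h h'
    by (simp add: \<phi>_def distrib_right laurent_add add_divide_distrib char_mod_ring_add)
  obtain e where e: "e < m" "fls_nth (laurent (Polynomial.monom 1 e * g) / laurent p) 1 \<noteq> 0"
    using nonzero_residue[OF m g p] .
  define h0 where "h0 = Polynomial.monom (1 :: 'b mod_ring) e"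
  have h0: "h0 \<in> H" "\<phi> h0 \<noteq> 1" using e by (auto simp: h0_def H_def \<phi>_def char_mod_ring_eq_1_iff)
  have "(\<Sum>h\<in>H. \<phi> h) = (\<Sum>h\<in>H. \<phi> (h + h0))"
    by (rule sum.reindex_bij_witness[where i = "\<lambda>h. h + h0" and j = "\<lambda>h. h - h0"])
       (use h0(1) in \<open>auto simp: H_def\<close>)
  also have "\<dots> = (\<Sum>h\<in>H. \<phi> h) * \<phi> h0" by (simp add: add sum_distrib_right)
  finally have "(\<Sum>h\<in>H. \<phi> h) = 0" using h0(2) by simp
  moreover have "(\<Sum>n<CARD('b) ^ m. \<phi> (nat_poly n)) = (\<Sum>h\<in>H. \<phi> h)"
    unfolding H_def by (rule sum.reindex_bij_betw[OF bij_betw_nat_poly])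
  ultimately show ?thesis by (simp add: \<phi>_def)
qed

text \<open>Multiplication by x^i moves the coefficient of x^(-i-1) to x^(-1), so this residue pairs
  the digits of \<open>k\<close> with those of a lattice point.\<close>

lemma residue_mult_tr_poly:
  fixes f p :: "'b::prime_card mod_ring poly"
  shows "fls_nth (laurent (f * tr_poly m k) / laurent p) 1
    = (\<Sum>i<m. fls_nth (laurent f / laurent p) (int (Suc i)) * of_nat (nat_digit CARD('b) k i))"
proof -
  define c where "c i = (of_nat (nat_digit CARD('b) k i) :: 'b mod_ring)" for i
  define F where "F = laurent f / laurent p"
  have "laurent (f * tr_poly m k) / laurent p = (\<Sum>i<m. fls_const (c i) * (fls_X_inv ^ i * F))"
    unfolding tr_poly_def laurent_mult laurent_sum laurent_monom F_def c_def
    by (simp add: sum_distrib_left sum_divide_distrib mult_ac)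
  then show ?thesis
    unfolding F_def[symmetric] c_def[symmetric]
    by (simp add: fls_nth_sum fls_X_inv_power_times_conv_shift mult.commute add.commute)
qed

text \<open>The exponent is that of a Walsh function with the digits of the lattice point written
  out. Read in the field it is the residue of \<open>nat_poly n * g / p\<close>, and
  \<open>p\<close> does not divide \<open>g\<close> outside the dual lattice.\<close>

lemma lattice_character_sum:
  fixes p :: "'b::prime_card mod_ring poly"
  assumes m: "Polynomial.degree p = m" and p: "p \<noteq> 0"
    and k: "k \<in> {1..t} \<rightarrow>\<^sub>E UNIV" "k \<notin> dual_lattice m t q p"
  shows "(\<Sum>n<CARD('b) ^ m. exp (2 * pi * \<i> / CARD('b)) ^ (\<Sum>j=1..t. \<Sum>i<m.
      nat (to_int_mod_ring (fls_nth (laurent (nat_poly n * q j) / laurent p) (int (Suc i))))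
        * nat_digit CARD('b) (k j) i)) = 0"
proof -
  define g where "g = (\<Sum>j=1..t. tr_poly m (k j) * q j)"
  have "\<not> p dvd g" using k by (simp add: dual_lattice_def g_def cong_0_iff)
  from char_sum_eq_0[OF m p this]
  have "(\<Sum>n<CARD('b) ^ m. char_mod_ring (fls_nth (laurent (nat_poly n * g) / laurent p) 1)) = 0" .
  moreover have "char_mod_ring (fls_nth (laurent (nat_poly n * g) / laurent p) 1)
     = exp (2 * pi * \<i> / CARD('b)) ^ (\<Sum>j=1..t. \<Sum>i<m.
      nat (to_int_mod_ring (fls_nth (laurent (nat_poly n * q j) / laurent p) (int (Suc i))))
        * nat_digit CARD('b) (k j) i)" (is "_ = _ ^ ?e") for n
  proof -
    have val: "of_nat (nat (to_int_mod_ring z)) = z" for z :: "'b mod_ring"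
    proof -
      have "to_int_mod_ring z \<ge> 0" using range_to_int_mod_ring[where 'a = 'b] by auto
      then show ?thesis by (simp add: of_nat_of_int_mod_ring)
    qed
    have "nat_poly n * g = (\<Sum>j=1..t. (nat_poly n * q j) * tr_poly m (k j))"
      by (simp add: g_def sum_distrib_left mult_ac)
    then have "fls_nth (laurent (nat_poly n * g) / laurent p) 1
        = (\<Sum>j=1..t. fls_nth (laurent ((nat_poly n * q j) * tr_poly m (k j)) / laurent p) 1)"
      by (simp only: laurent_sum sum_divide_distrib fls_nth_sum)
    also have "\<dots> = of_nat ?e"
      unfolding residue_mult_tr_poly by (simp add: val)
    finally show ?thesis by (simp only: char_mod_ring_of_nat)
  qed
  ultimately show ?thesis by simp
qed

subsection \<open>Sums of largest elements\<close>

lemma sum_le_sum_list_take: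
  fixes xs :: "nat list"
  assumes "sorted_wrt (>) xs" "T \<subseteq> set xs" "card T \<le> n"
  shows "\<Sum>T \<le> sum_list (take n xs)"
  using assms
proof (induction xs arbitrary: n T)
  case (Cons x xs)
  have fin: "finite T" using Cons.prems(2) by (rule finite_subset) simp
  show ?case
  proof (cases "T = {}")
    case False
    then have "card T \<noteq> 0" using fin by simp
    then obtain n' where n: "n = Suc n'" using Cons.prems(3) by (cases n) auto
    \<comment> \<open>If \<open>x\<close> lies in \<open>T\<close> it must be the element removed,
      to leave a subset of \<open>xs\<close>; otherwise any element will do, being at most
      \<open>x\<close>.\<close>
    obtain e where e: "e \<in> T" "e = x \<or> x \<notin> T" using False by auto
    have "e = x \<or> e \<in> set xs" using e(1) Cons.prems(2) by auto
    then have "e \<le> x" using Cons.prems(1) by auto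
    have "\<Sum>(T - {e}) \<le> sum_list (take n' xs)"
    proof (rule Cons.IH)
      show "T - {e} \<subseteq> set xs" using e Cons.prems(2) by auto
      show "card (T - {e}) \<le> n'" using e(1) fin Cons.prems(3) n by simp
    qed (use Cons.prems(1) in simp)
    moreover have "\<Sum>T = e + \<Sum>(T - {e})" using fin e(1) by (simp add: sum.remove)
    ultimately show ?thesis using \<open>e \<le> x\<close> n by simp
  qed simp
qed simp

text \<open>The mean of the \<open>c\<close> largest elements is at least the mean of all, stated
  without division. The induction goes down from \<open>card P\<close>: dropping the minimum does
  not lower the mean.\<close>

lemma large_subset_sum:
  fixes P :: "nat set"
  assumes "finite P" "c \<le> card P"
  shows "\<exists>T\<subseteq>P. card T = c \<and> c * \<Sum>P \<le> card P * \<Sum>T"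
  using assms(2)
proof (induction rule: inc_induct)
  case base
  show ?case by (intro exI[of _ P]) simp
next
  case (step n)
  then obtain T where T: "T \<subseteq> P" "card T = Suc n" "Suc n * \<Sum>P \<le> card P * \<Sum>T" by auto
  have fin: "finite T" using T(1) assms(1) finite_subset by blast
  define e where "e = Min T"
  have ne: "T \<noteq> {}" using T(2) by auto
  have e: "e \<in> T" unfolding e_def using fin ne by simp
  have sum: "\<Sum>T = e + \<Sum>(T - {e})" using fin e by (simp add: sum.remove)
  have card: "card (T - {e}) = n" using fin e T(2) by simp
  have "(\<Sum>x\<in>T - {e}. e) \<le> \<Sum>(T - {e})" unfolding e_def by (intro sum_mono) (simp add: fin)
  then have "n * e \<le> \<Sum>(T - {e})" using card by simp
  then have "n * \<Sum>T \<le> Suc n * \<Sum>(T - {e})" by (simp add: sum distrib_left)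
  then have "card P * (n * \<Sum>T) \<le> card P * (Suc n * \<Sum>(T - {e}))" by (rule mult_left_mono) simp
  moreover have "n * (Suc n * \<Sum>P) \<le> n * (card P * \<Sum>T)" using T(3) by (rule mult_left_mono) simp
  ultimately have "n * (Suc n * \<Sum>P) \<le> card P * (Suc n * \<Sum>(T - {e}))"
    by (metis mult.left_commute order_trans)
  then have "Suc n * (n * \<Sum>P) \<le> Suc n * (card P * \<Sum>(T - {e}))"
    by (metis mult.left_commute)
  then have "n * \<Sum>P \<le> card P * \<Sum>(T - {e})" by (rule mult_left_le_imp_le) simp
  then show ?case using T(1) card by (intro exI[of _ "T - {e}"]) auto
qed

text \<open>A new maximum \<open>x\<close> of a set \<open>A\<close> of naturals satisfies
  \<open>x \<ge> card A\<close>, so the sum is at least that of 1 up to the cardinality.\<close>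

lemma sum_Suc_ge:
  assumes "finite (R :: nat set)"
  shows "card R * (card R + 1) \<le> 2 * (\<Sum>r\<in>R. Suc r)"
  using assms
proof (induction rule: finite_linorder_max_induct)
  case (insert x A)
  have "A \<subseteq> {..<x}" using insert.hyps by auto
  then have "card A \<le> x" by (metis card_lessThan card_mono finite_lessThan)
  moreover have "x \<notin> A" using insert.hyps by auto
  ultimately show ?case using insert by simp
qed simp

subsection \<open>The decay functions under interlacing\<close>

text \<open>Since \<open>l < b ^ l\<close>, the range \<open>a < l\<close> covers all non-zero digits.\<close>

definition deinterlace :: "nat \<Rightarrow> nat \<Rightarrow> nat \<Rightarrow> nat \<Rightarrow> nat" where
  "deinterlace b d l r = (\<Sum>a<l. nat_digit b l (a * d + r) * b ^ a)"

lemma nat_digit_deinterlace: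
  assumes b: "b \<ge> 2" and d: "d \<ge> 1"
  shows "nat_digit b (deinterlace b d l r) a = nat_digit b l (a * d + r)"
proof -
  have "nat_digit b l (a * d + r) = 0" if "\<not> a < l"
  proof (rule nat_digit_eq_0_self[OF b])
    have "a \<le> a * d" using d by (cases d) auto
    then show "l \<le> a * d + r" using that by linarith
  qed
  then show ?thesis
    using b unfolding deinterlace_def by (subst nat_digit_sum) (auto intro: nat_digit_less)
qed

lemma deinterlace_0 [simp]: "deinterlace b d 0 r = 0"
  by (simp add: deinterlace_def)

text \<open>Every position \<open>i\<close> occurs in the parts: as digit \<open>i div d\<close> of
  part \<open>i mod d\<close>.\<close>

lemma deinterlace_inject:
  assumes b: "b \<ge> 2" and d: "d \<ge> 1" and eq: "\<And>r. r < d \<Longrightarrow> deinterlace b d l r = deinterlace b d l' r"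
  shows "l = l'"
proof (rule nat_digit_inject[OF b])
  fix i
  have "i mod d < d" using d by simp
  from eq[OF this] have "nat_digit b l (i div d * d + i mod d) = nat_digit b l' (i div d * d + i mod d)"
    by (metis nat_digit_deinterlace[OF b d])
  then show "nat_digit b l i = nat_digit b l' i" by simp
qed

lemma deinterlace_nonzero_ex:
  assumes "b \<ge> 2" "d \<ge> 1" "l \<noteq> 0"
  shows "\<exists>r<d. deinterlace b d l r \<noteq> 0"
proof (rule ccontr)
  assume "\<not> ?thesis"
  then have "deinterlace b d l r = deinterlace b d 0 r" if "r < d" for r using that by simp
  from deinterlace_inject[OF assms(1,2) this] show False using assms(3) by simp
qed

section \<open>Positions of non-zero digits and their largest elements\<close>

definition digit_positions :: "nat \<Rightarrow> nat \<Rightarrow> nat set" where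
  "digit_positions b k = {a. 1 \<le> a \<and> nat_digit b k (a - 1) \<noteq> 0}"

lemma finite_digit_positions:
  assumes "b \<ge> 2"
  shows "finite (digit_positions b k)"
proof (rule finite_subset)
  show "digit_positions b k \<subseteq> {..k}"
  proof
    fix a assume "a \<in> digit_positions b k"
    then have "\<not> k \<le> a - 1" using nat_digit_eq_0_self[OF assms] by (auto simp: digit_positions_def)
    then show "a \<in> {..k}" by simp
  qed
qed simp

text \<open>An upper bound on \<open>r_decay\<close> calls for a lower bound on \<open>mu\<close>,
  and for this any choice of at most \<open>\<alpha>\<close> positions serves.\<close>

lemma sum_le_mu:
  assumes "b \<ge> 2" "T \<subseteq> digit_positions b k" "card T \<le> \<alpha>"
  shows "\<Sum>T \<le> mu b \<alpha> k"
  unfolding mu_def digit_positions_def[symmetric]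
proof (rule sum_le_sum_list_take)
  show "sorted_wrt (>) (rev (sorted_list_of_set (digit_positions b k)))"
    by (simp add: sorted_wrt_rev)
  show "T \<subseteq> set (rev (sorted_list_of_set (digit_positions b k)))"
    using assms finite_digit_positions by simp
qed (fact assms(3))

lemma mu_1_in_digit_positions:
  assumes b: "b \<ge> 2" and k: "k \<noteq> 0"
  shows "mu b 1 k \<in> digit_positions b k"
proof -
  define xs where "xs = rev (sorted_list_of_set (digit_positions b k))"
  obtain i where "nat_digit b k i \<noteq> 0" using nat_digit_nonzero_ex[OF b k] by blast
  then have "Suc i \<in> digit_positions b k" by (simp add: digit_positions_def)
  then have set: "set xs = digit_positions b k" "xs \<noteq> []"
    using finite_digit_positions[OF b, of k] by (auto simp: xs_def)
  then have "take 1 xs = [hd xs]" by (cases xs) auto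
  then have "mu b 1 k = hd xs" unfolding mu_def digit_positions_def[symmetric] xs_def[symmetric] by simp
  then show ?thesis using set hd_in_set by metis
qed

text \<open>
  Average of the leading positions: at least \<open>min t \<alpha>\<close> of the \<open>t\<close> leading positions of the
  components enter \<open>\<mu>\<^sub>\<alpha>\<close>, and the largest of them are at least as large as their mean.
\<close>

lemma mu_deinterlace_ge:
  assumes b: "b \<ge> 2" and d: "d \<ge> 1"
    and R: "R = {r. r < d \<and> deinterlace b d l r \<noteq> 0}"
  shows "min (card R) \<alpha> * (\<Sum>r\<in>R. (mu b 1 (deinterlace b d l r) - 1) * d + Suc r)
    \<le> card R * mu b \<alpha> l"
proof -
  \<comment> \<open>The position in \<open>l\<close> of the leading digit of part \<open>r\<close>.
    Positions count from 1 but parts and digits from 0, hence \<open>- 1\<close> and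
    \<open>Suc r\<close>. The residue of \<open>pos r - 1\<close> modulo \<open>d\<close> recovers
    \<open>r\<close>.\<close>
  define pos where "pos r = (mu b 1 (deinterlace b d l r) - 1) * d + Suc r" for r
  have "finite R" unfolding R by simp
  have inj: "inj_on pos R"
  proof (rule inj_onI)
    fix r r' assume r: "r \<in> R" "r' \<in> R" "pos r = pos r'"
    then have "(pos r - 1) mod d = (pos r' - 1) mod d" by simp
    then show "r = r'" using r(1,2) by (simp add: pos_def R)
  qed
  have sub: "pos ` R \<subseteq> digit_positions b l"
  proof
    fix x assume "x \<in> pos ` R"
    then obtain r where r: "r < d" "deinterlace b d l r \<noteq> 0" "x = pos r" by (auto simp: R)
    have "nat_digit b (deinterlace b d l r) (mu b 1 (deinterlace b d l r) - 1) \<noteq> 0"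
      using mu_1_in_digit_positions[OF b r(2)] by (simp add: digit_positions_def)
    then show "x \<in> digit_positions b l"
      by (simp add: nat_digit_deinterlace[OF b d] r(3) pos_def digit_positions_def)
  qed
  have card: "card (pos ` R) = card R" using inj by (rule card_image)
  obtain T where T: "T \<subseteq> pos ` R" "card T = min (card R) \<alpha>"
    "min (card R) \<alpha> * \<Sum>(pos ` R) \<le> card R * \<Sum>T"
    using large_subset_sum[of "pos ` R" "min (card R) \<alpha>"] \<open>finite R\<close> card by auto
  have "\<Sum>T \<le> mu b \<alpha> l" using T sub by (intro sum_le_mu[OF b]) auto
  then have "card R * \<Sum>T \<le> card R * mu b \<alpha> l" by simp
  moreover have "\<Sum>(pos ` R) = (\<Sum>r\<in>R. pos r)" using inj by (simp add: sum.reindex)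
  ultimately have "min (card R) \<alpha> * (\<Sum>r\<in>R. pos r) \<le> card R * mu b \<alpha> l"
    using T(3) by (metis order_trans)
  then show ?thesis unfolding pos_def .
qed

text \<open>Here \<open>t\<close> is the number of non-zero parts, \<open>S\<close> the sum of their
  leading positions and \<open>M\<close> the value of \<open>mu\<close>. The factor of
  \<open>min t \<alpha>\<close> in \<open>M\<close> bounds the sum of the corresponding positions in
  the interlaced number from below. The cases separate whether all \<open>t\<close> positions enter
  \<open>mu\<close> or only \<open>\<alpha>\<close> of them.\<close>

lemma interlacing_exponent_bound:
  fixes t d \<alpha> M S :: real
  assumes t: "1 \<le> t" "t \<le> d" and d: "d \<ge> 2" and \<alpha>: "\<alpha> \<ge> 1" and S: "S \<ge> t"
    and M: "min t \<alpha> * (d * (S - t) + t * (t + 1) / 2) \<le> t * M"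
  shows "min \<alpha> d * S + \<alpha> * t / 2 - \<alpha> * (2 * d - 1) / 2 \<le> M"
proof (cases "t \<le> \<alpha>")
  case True
  then have "t * (d * (S - t) + t * (t + 1) / 2) \<le> t * M" using M by (simp add: min_def)
  then have M1: "d * (S - t) + t * (t + 1) / 2 \<le> M" using t by (simp add: mult_le_cancel_left)
  show ?thesis
  proof (cases "\<alpha> \<le> d")
    case True
    have "\<alpha> * (S - t) \<le> d * (S - t)" using True S by (intro mult_right_mono) auto
    \<comment> \<open>What remains of the claim once the terms in \<open>S - t\<close> are compared
      and \<open>d\<close> is replaced by \<open>\<alpha>\<close>.\<close>
    moreover have "0 \<le> (\<alpha> - t) * (2 * \<alpha> - t - 1)" using \<open>t \<le> \<alpha>\<close> t by (intro mult_nonneg_nonneg) auto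
    moreover have "\<alpha> * \<alpha> \<le> \<alpha> * d" using True \<alpha> by (intro mult_left_mono) auto
    ultimately show ?thesis using M1 True by (simp add: min_def field_simps)
  next
    case False
    \<comment> \<open>The terms in \<open>S\<close> cancel, and this product is twice the remaining
      slack.\<close>
    have "0 \<le> (\<alpha> - t) * (2 * d - 1 - t)" using \<open>t \<le> \<alpha>\<close> t d by (intro mult_nonneg_nonneg) auto
    then show ?thesis using M1 False by (simp add: min_def field_simps)
  qed
next
  case False
  then have "\<alpha> * (d * (S - t) + t * (t + 1) / 2) \<le> t * M" using M by (simp add: min_def)
  \<comment> \<open>Lowering \<open>d\<close> to \<open>t\<close> makes \<open>t\<close> a common
    factor that can be cancelled.\<close>
  moreover have "\<alpha> * (t * (S - t)) \<le> \<alpha> * (d * (S - t))"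
    using t S \<alpha> by (intro mult_left_mono mult_right_mono) auto
  ultimately have "t * (\<alpha> * (S - t) + \<alpha> * (t + 1) / 2) \<le> t * M" by (simp add: field_simps)
  then have "\<alpha> * (S - t) + \<alpha> * (t + 1) / 2 \<le> M" using t by (simp add: mult_le_cancel_left)
  moreover have "\<alpha> * t \<le> \<alpha> * d" using t \<alpha> by (intro mult_left_mono) auto
  ultimately show ?thesis using False t by (simp add: min_def field_simps)
qed

text \<open>The price of interlacing for one component. Since \<open>r_tilde\<close> is 1 at 0, only
  the non-zero parts \<open>R\<close> count, and the claim reduces to comparing exponents of
  \<open>b\<close>.\<close>

lemma r_decay_le_prod_r_tilde:
  assumes b: "b \<ge> 2" and d: "d > 1" and \<alpha>: "\<alpha> > 1" and l: "l \<noteq> 0"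
  shows "r_decay b \<alpha> l
    \<le> b powr (real \<alpha> * (2 * real d - 1) / 2) * (\<Prod>r<d. r_tilde b \<alpha> d (deinterlace b d l r))"
proof -
  define R where "R = {r. r < d \<and> deinterlace b d l r \<noteq> 0}"
  define a where "a r = mu b 1 (deinterlace b d l r)" for r
  define S where "S = (\<Sum>r\<in>R. a r)"
  define t where "t = card R"
  have fin: "finite R" by (simp add: R_def)
  have "R \<noteq> {}" using deinterlace_nonzero_ex[of b d l] b d l by (auto simp: R_def)
  then have t1: "t \<ge> 1" using fin by (simp add: t_def Suc_le_eq card_gt_0_iff)
  have "R \<subseteq> {..<d}" by (auto simp: R_def)
  then have td: "t \<le> d" unfolding t_def by (metis card_lessThan card_mono finite_lessThan)
  have a1: "a r \<ge> 1" if "r \<in> R" for r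
    using mu_1_in_digit_positions[OF b, of "deinterlace b d l r"] that
    by (simp add: a_def R_def digit_positions_def)
  have St: "t \<le> S" unfolding t_def S_def card_eq_sum by (intro sum_mono a1)
  have "real (\<Sum>r\<in>R. (a r - 1) * d + Suc r) = real d * (real S - real t) + real (\<Sum>r\<in>R. Suc r)"
  proof -
    have "real (\<Sum>r\<in>R. (a r - 1) * d) = (\<Sum>r\<in>R. (real (a r) - 1) * real d)"
      unfolding of_nat_sum by (intro sum.cong refl) (use a1 in \<open>simp add: of_nat_diff\<close>)
    also have "\<dots> = real d * (real S - real t)"
      by (simp add: S_def t_def sum_subtractf flip: sum_distrib_right)
    finally show ?thesis by (simp add: sum.distrib)
  qed
  \<comment> \<open>The offsets \<open>Suc r\<close> are \<open>t\<close> distinct positive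
    integers.\<close>
  moreover have "real t * (real t + 1) / 2 \<le> real (\<Sum>r\<in>R. Suc r)"
  proof -
    have "real (t * (t + 1)) \<le> real (2 * (\<Sum>r\<in>R. Suc r))"
      unfolding t_def by (rule of_nat_mono[OF sum_Suc_ge[OF fin]])
    then show ?thesis unfolding of_nat_mult of_nat_add by simp
  qed
  ultimately have "min (real t) (real \<alpha>) * (real d * (real S - real t) + real t * (real t + 1) / 2)
      \<le> real (min t \<alpha>) * real (\<Sum>r\<in>R. (a r - 1) * d + Suc r)"
    by (simp add: of_nat_min mult_left_mono)
  also have "\<dots> \<le> real t * real (mu b \<alpha> l)"
    using mu_deinterlace_ge[OF b _ R_def, of \<alpha>] d
    unfolding of_nat_mult[symmetric] of_nat_le_iff t_def a_def by simp
  finally have "min (real \<alpha>) (real d) * real S + real \<alpha> * real t / 2 - real \<alpha> * (2 * real d - 1) / 2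
      \<le> real (mu b \<alpha> l)"
    using t1 td St d \<alpha> by (intro interlacing_exponent_bound) auto
  moreover have "(\<Sum>r\<in>R. - (min (real \<alpha>) (real d)) * real (a r) - real \<alpha> / 2)
      = - (min (real \<alpha>) (real d)) * real S - real \<alpha> * real t / 2"
    unfolding sum_subtractf sum_distrib_left[symmetric] by (simp add: S_def t_def)
  ultimately have exps: "- real (mu b \<alpha> l) \<le> real \<alpha> * (2 * real d - 1) / 2
      + (\<Sum>r\<in>R. - (min (real \<alpha>) (real d)) * real (a r) - real \<alpha> / 2)"
    by simp
  have "(\<Prod>r<d. r_tilde b \<alpha> d (deinterlace b d l r)) = (\<Prod>r\<in>R. r_tilde b \<alpha> d (deinterlace b d l r))"
    by (rule prod.mono_neutral_right) (auto simp: R_def r_tilde_def)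
  also have "\<dots> = (\<Prod>r\<in>R. b powr (- (min (real \<alpha>) (real d)) * real (a r) - real \<alpha> / 2))"
    by (intro prod.cong) (auto simp: R_def r_tilde_def a_def of_nat_min)
  also have "\<dots> = b powr (\<Sum>r\<in>R. - (min (real \<alpha>) (real d)) * real (a r) - real \<alpha> / 2)"
    using b fin by (subst powr_sum) auto
  finally show ?thesis
    using exps b by (simp add: r_decay_def flip: powr_add)
qed

subsection \<open>Walsh functions at interlaced points\<close>

text \<open>The inverse counterpart of \<open>interlace_vec\<close> on frequencies: component
  \<open>j\<close> belongs to block \<open>Suc ((j - 1) div d)\<close>, counted from 1, and is its
  part \<open>(j - 1) mod d\<close>, counted from 0.\<close>

definition deinterlace_vec :: "nat \<Rightarrow> nat \<Rightarrow> nat \<Rightarrow> (nat \<Rightarrow> nat) \<Rightarrow> nat \<Rightarrow> nat" where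
  "deinterlace_vec b d s l =
     (\<lambda>j\<in>{1..d * s}. deinterlace b d (l (Suc ((j - 1) div d))) ((j - 1) mod d))"

lemma block_index_less:
  fixes i s r d :: nat
  assumes "i < s" "r < d"
  shows "i * d + r < s * d"
proof -
  have "i * d + r < Suc i * d" using assms(2) by simp
  also have "\<dots> \<le> s * d" using assms(1) by (intro mult_right_mono) auto
  finally show ?thesis .
qed

lemma deinterlace_vec_block:
  assumes "i < s" "r < d"
  shows "deinterlace_vec b d s l (Suc (i * d + r)) = deinterlace b d (l (Suc i)) r"
  using block_index_less[OF assms] assms by (simp add: deinterlace_vec_def mult.commute)

lemma deinterlace_vec_PiE: "deinterlace_vec b d s l \<in> {1..d * s} \<rightarrow>\<^sub>E UNIV"
  by (simp add: deinterlace_vec_def)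

lemma inj_on_deinterlace_vec:
  assumes b: "b \<ge> 2" and d: "d \<ge> 1"
  shows "inj_on (deinterlace_vec b d s) ({1..s} \<rightarrow>\<^sub>E UNIV)"
proof (rule inj_onI)
  fix l l' assume l: "l \<in> {1..s} \<rightarrow>\<^sub>E UNIV" "l' \<in> {1..s} \<rightarrow>\<^sub>E UNIV"
    "deinterlace_vec b d s l = deinterlace_vec b d s l'"
  show "l = l'"
  proof (rule PiE_ext[OF l(1,2)])
    fix j assume "j \<in> {1..s}"
    then obtain i where j: "j = Suc i" "i < s" by (cases j) auto
    show "l j = l' j" unfolding j(1)
    proof (rule deinterlace_inject[OF b d])
      fix r assume "r < d"
      with j(2) show "deinterlace b d (l (Suc i)) r = deinterlace b d (l' (Suc i)) r"
        by (metis l(3) deinterlace_vec_block)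
    qed
  qed
qed

text \<open>Finite digit sequences make the digits of the interlaced point explicit. The exponent of
  the Walsh function is then a sum over digit positions of \<open>l\<close>, which is regrouped by
  the residue of the position modulo \<open>d\<close>, that is, by the parts of
  \<open>l\<close>.\<close>

lemma
  assumes b: "b \<ge> 2" and d: "d \<ge> 1" and c: "\<And>j a. c j a < b"
    and z: "\<And>j a. j \<in> {1..d * s} \<Longrightarrow> real_digit b (z j) (Suc a) = (if a < m then c j a else 0)"
  shows interlace_vec_in_unit_cube: "interlace_vec b d s z \<in> unit_cube s" (is ?cube)
    and wal_vec_interlace_vec: "wal_vec b s l (interlace_vec b d s z)
      = exp (2 * pi * \<i> / b) ^ (\<Sum>j=1..d * s. \<Sum>a<m. c j a * nat_digit b (deinterlace_vec b d s l j) a)"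
      (is ?wal)
proof -
  define C where "C i n = c (Suc (i * d + n mod d)) (n div d)" for i n
  define y where "y i = interlace b d (\<lambda>r. z (i * d + r))" for i
  have y: "y i = (\<Sum>n<m * d. real (C i n) / real b ^ Suc n)" if "i < s" for i
    unfolding y_def C_def
  proof (rule interlace_finite_expansion[OF d])
    fix r a assume "r < d"
    then have "i * d + Suc r \<in> {1..d * s}"
      using block_index_less[OF that] by (simp add: mult.commute Suc_le_eq)
    then show "real_digit b (z (i * d + Suc r)) (Suc a) = (if a < m then c (Suc (i * d + r)) a else 0)"
      using z by simp
  qed
  have yvec: "interlace_vec b d s z (Suc i) = y i" if "i < s" for i
    using that by (simp add: interlace_vec_def y_def)
  have C: "C i n < b" for i n using c by (simp add: C_def)
  show ?cube unfolding unit_cube_def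
  proof (rule PiE_I)
    fix j assume "j \<in> {1..s}"
    then obtain i where j: "j = Suc i" "i < s" by (cases j) auto
    have "0 \<le> y i" unfolding y[OF j(2)] by (intro sum_nonneg) auto
    moreover have "y i < 1" unfolding y[OF j(2)] by (rule finite_expansion_less_1[OF b C])
    ultimately show "interlace_vec b d s z j \<in> {0..<1}" using yvec j by simp
  qed (auto simp: interlace_vec_def)
  define w where "w = exp (2 * pi * \<i> / b)"
  have walj: "wal b (l (Suc i)) (y i)
      = w ^ (\<Sum>r<d. \<Sum>a<m. c (Suc (i * d + r)) a * nat_digit b (deinterlace_vec b d s l (Suc (i * d + r))) a)"
    if i: "i < s" for i
  proof -
    have dig: "real_digit b (y i) (Suc n) = (if n < m * d then C i n else 0)" for n
      unfolding y[OF i] by (rule real_digit_finite_expansion[OF b C])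
    have "wal b (l (Suc i)) (y i) = w ^ (\<Sum>n<m * d. real_digit b (y i) (Suc n) * nat_digit b (l (Suc i)) n)"
      unfolding w_def by (rule wal_finite_expansion[OF b]) (simp add: dig)
    also have "(\<Sum>n<m * d. real_digit b (y i) (Suc n) * nat_digit b (l (Suc i)) n)
        = (\<Sum>n<m * d. C i n * nat_digit b (l (Suc i)) n)"
      by (intro sum.cong) (auto simp: dig)
    also have "\<dots> = (\<Sum>a<m. \<Sum>r<d. c (Suc (i * d + r)) a * nat_digit b (l (Suc i)) (a * d + r))"
      unfolding sum.nat_blocks by (intro sum.cong) (auto simp: C_def)
    also have "\<dots> = (\<Sum>r<d. \<Sum>a<m. c (Suc (i * d + r)) a * nat_digit b (l (Suc i)) (a * d + r))"
      by (rule sum.swap)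
    also have "\<dots> = (\<Sum>r<d. \<Sum>a<m. c (Suc (i * d + r)) a * nat_digit b (deinterlace_vec b d s l (Suc (i * d + r))) a)"
      by (intro sum.cong) (auto simp: deinterlace_vec_block[OF i] nat_digit_deinterlace[OF b d])
    finally show ?thesis .
  qed
  have "wal_vec b s l (interlace_vec b d s z) = (\<Prod>i<s. wal b (l (Suc i)) (y i))"
    unfolding wal_vec_def One_nat_def prod.atLeast1_atMost_eq by (intro prod.cong) (auto simp: yvec)
  also have "\<dots> = w ^ (\<Sum>i<s. \<Sum>r<d. \<Sum>a<m.
      c (Suc (i * d + r)) a * nat_digit b (deinterlace_vec b d s l (Suc (i * d + r))) a)"
    unfolding power_sum[of w _ "{..<s}"] by (intro prod.cong refl walj) simp
  also have "(\<Sum>i<s. \<Sum>r<d. \<Sum>a<m.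
      c (Suc (i * d + r)) a * nat_digit b (deinterlace_vec b d s l (Suc (i * d + r))) a)
    = (\<Sum>j=1..d * s. \<Sum>a<m. c j a * nat_digit b (deinterlace_vec b d s l j) a)"
    unfolding One_nat_def sum.atLeast1_atMost_eq mult.commute[of d s] sum.nat_blocks ..
  finally show ?wal by (simp add: w_def)
qed

text \<open>Representatives of field elements lie between 0 and \<open>b - 1\<close>, so the sum in
  \<open>v_trunc\<close> is already a finite \<open>b\<close>-adic expansion.\<close>

lemma real_digit_lattice_point:
  fixes p :: "'b::prime_card mod_ring poly"
  assumes "j \<in> {1..t}"
  shows "real_digit CARD('b) (lattice_point m t q p n j) (Suc a) =
    (if a < m then nat (to_int_mod_ring (fls_nth (laurent (nat_poly n * q j) / laurent p) (int (Suc a)))) else 0)"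
proof -
  define c where "c a = nat (to_int_mod_ring (fls_nth (laurent (nat_poly n * q j) / laurent p) (int (Suc a))))" for a
  have rng: "0 \<le> to_int_mod_ring z" "to_int_mod_ring z < int CARD('b)" for z :: "'b mod_ring"
    using range_to_int_mod_ring[where 'a = 'b] by auto
  have "lattice_point m t q p n j = (\<Sum>a<m. real (c a) / real CARD('b) ^ Suc a)"
    using assms rng(1) unfolding lattice_point_def v_trunc_def One_nat_def sum.atLeast1_atMost_eq
    by (simp add: c_def)
  moreover have "c a < CARD('b)" for a
    using rng unfolding c_def by (simp add: nat_less_iff)
  ultimately show ?thesis
    using real_digit_finite_expansion[of "CARD('b)" c m a] CARD_prime_card_ge_2[where 'b = 'b]
    by (simp add: c_def)
qed

subsection \<open>Walsh coefficients\<close>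

text \<open>The support \<open>v\<close> of \<open>l\<close> selects the term of the norm to be read
  off. For \<open>\<gamma> v = 0\<close> the coefficient vanishes by membership in
  \<open>walsh_space\<close>.\<close>

lemma walsh_coeff_le:
  assumes f: "f \<in> walsh_space b s \<alpha> \<gamma>" "walsh_norm b s \<alpha> \<gamma> f \<le> 1" and b: "b \<ge> 2"
    and \<gamma>: "\<And>v. v \<subseteq> {1..s} \<Longrightarrow> \<gamma> v \<ge> 0"
    and l: "l \<in> {1..s} \<rightarrow>\<^sub>E UNIV" and v: "v = {j \<in> {1..s}. l j \<noteq> 0}"
  shows "cmod (walsh_coeff b s f l) \<le> \<gamma> v * (\<Prod>j\<in>v. r_decay b \<alpha> (l j))"
proof -
  have vs: "v \<subseteq> {1..s}" by (auto simp: v)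
  define l' where "l' = restrict l v"
  have l': "l' \<in> v \<rightarrow>\<^sub>E {1..}" by (auto simp: l'_def v)
  have pad: "pad s v l' = l"
    by (rule PiE_ext[of _ "{1..s}" "\<lambda>_. UNIV"]) (use l in \<open>auto simp: pad_def l'_def v\<close>)
  have prod: "(\<Prod>j\<in>v. r_decay b \<alpha> (l' j)) = (\<Prod>j\<in>v. r_decay b \<alpha> (l j))" (is "_ = ?r")
    by (intro prod.cong) (auto simp: l'_def)
  have r: "?r > 0" using b by (intro prod_pos) (auto simp: r_decay_def)
  show ?thesis
  proof (cases "\<gamma> v = 0")
    case True
    then have "walsh_coeff b s f (pad s v l') = 0" using f(1) vs l' by (auto simp: walsh_space_def)
    then show ?thesis using True pad by simp
  next
    case False
    then have g: "\<gamma> v > 0" using \<gamma>[OF vs] by simp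
    have "ennreal (cmod (walsh_coeff b s f (pad s v l')) / (\<Prod>j\<in>v. r_decay b \<alpha> (l' j)))
        \<le> (SUP l\<in>(v \<rightarrow>\<^sub>E {1..}). ennreal (cmod (walsh_coeff b s f (pad s v l)) / (\<Prod>j\<in>v. r_decay b \<alpha> (l j))))"
      by (rule SUP_upper[OF l'])
    then have "ennreal (inverse (\<gamma> v)) * ennreal (cmod (walsh_coeff b s f l) / ?r)
        \<le> ennreal (inverse (\<gamma> v)) *
          (SUP l\<in>(v \<rightarrow>\<^sub>E {1..}). ennreal (cmod (walsh_coeff b s f (pad s v l)) / (\<Prod>j\<in>v. r_decay b \<alpha> (l j))))"
      unfolding pad prod by (intro mult_left_mono) auto
    also have "\<dots> \<le> walsh_norm b s \<alpha> \<gamma> f"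
      unfolding walsh_norm_def by (rule SUP_upper) (use False vs in auto)
    also have "\<dots> \<le> 1" by (fact f(2))
    finally have "ennreal (inverse (\<gamma> v) * (cmod (walsh_coeff b s f l) / ?r)) \<le> 1"
      using g r by (subst ennreal_mult) auto
    then have "inverse (\<gamma> v) * (cmod (walsh_coeff b s f l) / ?r) \<le> 1"
      by (simp add: ennreal_le_1)
    then show ?thesis using g r by (simp add: field_simps)
  qed
qed

text \<open>As \<open>r_tilde\<close> is 1 at 0, both products extend to all indices, where they
  differ only by grouping into blocks.\<close>

lemma prod_r_tilde_deinterlace_vec:
  "(\<Prod>j | j \<in> {1..d * s} \<and> deinterlace_vec b d s l j \<noteq> 0. r_tilde b \<alpha> d (deinterlace_vec b d s l j))
    = (\<Prod>j\<in>{j \<in> {1..s}. l j \<noteq> 0}. \<Prod>r<d. r_tilde b \<alpha> d (deinterlace b d (l j) r))"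
proof -
  have "(\<Prod>j | j \<in> {1..d * s} \<and> deinterlace_vec b d s l j \<noteq> 0. r_tilde b \<alpha> d (deinterlace_vec b d s l j))
      = (\<Prod>j\<in>{1..d * s}. r_tilde b \<alpha> d (deinterlace_vec b d s l j))"
    by (rule prod.mono_neutral_left) (auto simp: r_tilde_def)
  also have "\<dots> = (\<Prod>i<s. \<Prod>r<d. r_tilde b \<alpha> d (deinterlace_vec b d s l (Suc (i * d + r))))"
    unfolding One_nat_def prod.atLeast1_atMost_eq mult.commute[of d s] prod.nat_blocks ..
  also have "\<dots> = (\<Prod>i<s. \<Prod>r<d. r_tilde b \<alpha> d (deinterlace b d (l (Suc i)) r))"
    by (intro prod.cong refl) (simp add: deinterlace_vec_block)
  also have "\<dots> = (\<Prod>j\<in>{1..s}. \<Prod>r<d. r_tilde b \<alpha> d (deinterlace b d (l j) r))"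
    unfolding One_nat_def prod.atLeast1_atMost_eq ..
  also have "\<dots> = (\<Prod>j\<in>{j \<in> {1..s}. l j \<noteq> 0}. \<Prod>r<d. r_tilde b \<alpha> d (deinterlace b d (l j) r))"
    by (rule prod.mono_neutral_right) (auto simp: r_tilde_def)
  finally show ?thesis .
qed

text \<open>A component of \<open>l\<close> is non-zero exactly if one of its \<open>d\<close> parts
  is. Thus \<open>w(u)\<close> recovers the support of \<open>l\<close>, and with it the right
  weight.\<close>

lemma blocks_deinterlace_vec:
  assumes b: "b \<ge> 2" and d: "d \<ge> 1"
  shows "blocks d s {j \<in> {1..d * s}. deinterlace_vec b d s l j \<noteq> 0} = {j \<in> {1..s}. l j \<noteq> 0}"
proof -
  have "{j' \<in> {1..d * s}. deinterlace_vec b d s l j' \<noteq> 0} \<inter> {(j - 1) * d + 1..j * d} \<noteq> {} \<longleftrightarrow> l j \<noteq> 0"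
    if j: "j \<in> {1..s}" for j
  proof -
    obtain i where i: "j = Suc i" "i < s" using j by (cases j) auto
    show ?thesis
    proof
      assume "{j' \<in> {1..d * s}. deinterlace_vec b d s l j' \<noteq> 0} \<inter> {(j - 1) * d + 1..j * d} \<noteq> {}"
      then obtain j' where j': "i * d + 1 \<le> j'" "j' \<le> Suc i * d" "deinterlace_vec b d s l j' \<noteq> 0"
        by (auto simp: i(1))
      define r where "r = j' - 1 - i * d"
      have "r < d" "j' = Suc (i * d + r)" using j'(1,2) d by (auto simp: r_def)
      with j'(3) i have "deinterlace b d (l j) r \<noteq> 0" by (simp add: deinterlace_vec_block)
      then show "l j \<noteq> 0" by (cases "l j = 0") auto
    next
      assume "l j \<noteq> 0"
      then obtain r where r: "r < d" "deinterlace b d (l j) r \<noteq> 0"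
        using deinterlace_nonzero_ex[OF b d] by blast
      have "Suc (i * d + r) \<in> {1..d * s}"
        using block_index_less[OF i(2) r(1)] by (simp add: mult.commute)
      then have "Suc (i * d + r) \<in> {j' \<in> {1..d * s}. deinterlace_vec b d s l j' \<noteq> 0} \<inter> {(j - 1) * d + 1..j * d}"
        using r i deinterlace_vec_block[OF i(2) r(1), of b l] by simp
      then show "{j' \<in> {1..d * s}. deinterlace_vec b d s l j' \<noteq> 0} \<inter> {(j - 1) * d + 1..j * d} \<noteq> {}"
        by blast
    qed
  qed
  then show ?thesis unfolding blocks_def by blast
qed

text \<open>One factor \<open>b powr e\<close> arises per non-zero component; together they are the
  factor by which \<open>weight_tilde\<close> exceeds \<open>\<gamma>\<close>.\<close>

lemma prod_r_decay_le:
  assumes b: "b \<ge> 2" and d: "d > 1" and \<alpha>: "\<alpha> > 1"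
    and v: "v = {j \<in> {1..s}. l j \<noteq> 0}" and \<gamma>: "\<gamma> v \<ge> 0"
    and u: "u = {j \<in> {1..d * s}. deinterlace_vec b d s l j \<noteq> 0}"
  shows "\<gamma> v * (\<Prod>j\<in>v. r_decay b \<alpha> (l j))
    \<le> weight_tilde b d \<alpha> \<gamma> (blocks d s u) * (\<Prod>j\<in>u. r_tilde b \<alpha> d (deinterlace_vec b d s l j))"
proof -
  define e where "e = real \<alpha> * (2 * real d - 1) / 2"
  have "(\<Prod>j\<in>v. r_decay b \<alpha> (l j))
      \<le> (\<Prod>j\<in>v. b powr e * (\<Prod>r<d. r_tilde b \<alpha> d (deinterlace b d (l j) r)))"
    unfolding e_def by (intro prod_mono conjI r_decay_le_prod_r_tilde[OF b d \<alpha>]) (auto simp: v r_decay_def)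
  also have "\<dots> = (b powr e) ^ card v * (\<Prod>j\<in>u. r_tilde b \<alpha> d (deinterlace_vec b d s l j))"
    unfolding prod.distrib u v using prod_r_tilde_deinterlace_vec by simp
  also have "(b powr e) ^ card v = b powr (real \<alpha> * (2 * real d - 1) * real (card v) / 2)"
    using b by (simp add: e_def powr_power mult_ac)
  finally have "\<gamma> v * (\<Prod>j\<in>v. r_decay b \<alpha> (l j)) \<le> \<gamma> v * (b powr (real \<alpha> * (2 * real d - 1) * real (card v) / 2)
      * (\<Prod>j\<in>u. r_tilde b \<alpha> d (deinterlace_vec b d s l j)))"
    using \<gamma> by (rule mult_left_mono)
  moreover have "blocks d s u = v" unfolding u v using b d by (intro blocks_deinterlace_vec) auto
  ultimately show ?thesis by (simp add: weight_tilde_def mult_ac)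
qed

subsection \<open>The error bound\<close>

lemma has_sum_finite_sum:
  fixes f :: "'i \<Rightarrow> 'a \<Rightarrow> 'c::topological_comm_monoid_add"
  assumes "\<And>i. i \<in> I \<Longrightarrow> (f i has_sum S i) A"
  shows "((\<lambda>x. \<Sum>i\<in>I. f i x) has_sum (\<Sum>i\<in>I. S i)) A"
  using assms by (induction I rule: infinite_finite_induct) (auto intro: has_sum_add)

text \<open>Norm bounds on finite partial sums pass to the limit. With \<open>B\<close> in
  \<open>ennreal\<close> the case of a divergent right-hand side is covered as well.\<close>

lemma norm_has_sum_le_ennreal:
  fixes f :: "'a \<Rightarrow> 'b::real_normed_vector"
  assumes f: "(f has_sum S) A"
    and le: "\<And>F. finite F \<Longrightarrow> F \<subseteq> A \<Longrightarrow> ennreal (norm (sum f F)) \<le> B"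
  shows "ennreal (norm S) \<le> B"
proof (cases B)
  case (real r)
  have "norm (sum f F) \<le> r" if "finite F" "F \<subseteq> A" for F
    using le[OF that] real by (simp add: ennreal_le_iff)
  then have "eventually (\<lambda>F. norm (sum f F) \<le> r) (finite_subsets_at_top A)"
    by (rule eventually_finite_subsets_at_top_weakI)
  moreover have "((\<lambda>F. norm (sum f F)) \<longlongrightarrow> norm S) (finite_subsets_at_top A)"
    using f unfolding has_sum_def by (rule tendsto_norm)
  ultimately have "norm S \<le> r"
    by (intro tendsto_upperbound) (auto simp: finite_subsets_at_top_neq_bot)
  then show ?thesis using real by (simp add: ennreal_leI)
qed simp

lemma walsh_coeff_0:
  assumes "b \<ge> 2"
  shows "walsh_coeff b s f (\<lambda>j\<in>{1..s}. 0) = of_real (LINT x|cube_measure s. f x)"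
  using assms by (simp add: walsh_coeff_def wal_vec_def)

lemma norm_wal_vec [simp]: "cmod (wal_vec b s l x) = 1"
  by (simp add: wal_vec_def flip: prod_norm)

lemma finite_sum_le_infsum_ennreal:
  fixes f :: "'a \<Rightarrow> ennreal"
  assumes "finite F" "F \<subseteq> A"
  shows "sum f F \<le> infsum f A"
  unfolding nonneg_infsum_complete[of A f, OF zero_le] by (rule SUP_upper) (use assms in auto)

text \<open>The vectors are grouped by support \<open>u\<close>. On each group restriction to
  \<open>u\<close> is injective with inverse \<open>pad\<close>, so the group is a finite part of
  the infinite sum belonging to \<open>u\<close>.\<close>

lemma sum_by_support_le:
  fixes h :: "(nat \<Rightarrow> nat) \<Rightarrow> real" and D :: "(nat \<Rightarrow> nat) set"
  assumes X: "finite X" "X \<subseteq> D" "D \<subseteq> {1..t} \<rightarrow>\<^sub>E UNIV" "(\<lambda>j\<in>{1..t}. 0) \<notin> X"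
    and supp: "\<And>k. supp k = {j \<in> {1..t}. k j \<noteq> (0::nat)}"
  shows "(\<Sum>k\<in>X. W (supp k) * ennreal (\<Prod>j\<in>supp k. g (k j)))
    \<le> (\<Sum>u | u \<subseteq> {1..t} \<and> u \<noteq> {}. W u *
         (\<Sum>\<^sub>\<infinity>k\<in>{k \<in> u \<rightarrow>\<^sub>E {1..}. pad t u k \<in> D}. ennreal (\<Prod>j\<in>u. g (k j))))"
proof -
  define U where "U = {u. u \<subseteq> {1..t} \<and> u \<noteq> {}}"
  have "finite U" by (rule finite_subset[of _ "Pow {1..t}"]) (auto simp: U_def)
  moreover have "supp ` X \<subseteq> U"
  proof (rule image_subsetI)
    fix k assume k: "k \<in> X"
    have "supp k \<noteq> {}"
    proof
      assume "supp k = {}"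
      then have "k = (\<lambda>j\<in>{1..t}. 0)"
        using X(2,3) k by (intro PiE_ext[of k "{1..t}" "\<lambda>_. UNIV"]) (auto simp: supp)
      then show False using k X(4) by simp
    qed
    then show "supp k \<in> U" by (auto simp: U_def supp)
  qed
  ultimately have "(\<Sum>k\<in>X. W (supp k) * ennreal (\<Prod>j\<in>supp k. g (k j)))
      = (\<Sum>u\<in>U. \<Sum>k\<in>{k \<in> X. supp k = u}. W (supp k) * ennreal (\<Prod>j\<in>supp k. g (k j)))"
    using X(1) by (intro sum.group[symmetric])
  also have "\<dots> \<le> (\<Sum>u\<in>U. W u * (\<Sum>\<^sub>\<infinity>k\<in>{k \<in> u \<rightarrow>\<^sub>E {1..}. pad t u k \<in> D}. ennreal (\<Prod>j\<in>u. g (k j))))"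
  proof (rule sum_mono)
    fix u assume "u \<in> U"
    define Xu where "Xu = {k \<in> X. supp k = u}"
    have pad: "pad t u (restrict k u) = k" if "k \<in> Xu" for k
      by (rule PiE_ext[of _ "{1..t}" "\<lambda>_. UNIV"])
         (use that X(2,3) in \<open>auto simp: Xu_def pad_def supp\<close>)
    have inj: "inj_on (\<lambda>k. restrict k u) Xu" by (rule inj_on_inverseI) (rule pad)
    have "(\<Sum>k\<in>Xu. ennreal (\<Prod>j\<in>u. g (k j))) = (\<Sum>k\<in>(\<lambda>k. restrict k u) ` Xu. ennreal (\<Prod>j\<in>u. g (k j)))"
      using inj by (simp add: sum.reindex)
    also have "\<dots> \<le> (\<Sum>\<^sub>\<infinity>k\<in>{k \<in> u \<rightarrow>\<^sub>E {1..}. pad t u k \<in> D}. ennreal (\<Prod>j\<in>u. g (k j)))"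
    proof (rule finite_sum_le_infsum_ennreal)
      show "finite ((\<lambda>k. restrict k u) ` Xu)" using X(1) by (simp add: Xu_def)
      show "(\<lambda>k. restrict k u) ` Xu \<subseteq> {k \<in> u \<rightarrow>\<^sub>E {1..}. pad t u k \<in> D}"
      proof (rule image_subsetI)
        fix k assume k: "k \<in> Xu"
        then have "restrict k u \<in> u \<rightarrow>\<^sub>E {1..}" by (auto simp: Xu_def supp Suc_le_eq)
        then show "restrict k u \<in> {k \<in> u \<rightarrow>\<^sub>E {1..}. pad t u k \<in> D}"
          using pad[OF k] k X(2) by (auto simp: Xu_def)
      qed
    qed
    finally have "W u * (\<Sum>k\<in>Xu. ennreal (\<Prod>j\<in>u. g (k j)))
        \<le> W u * (\<Sum>\<^sub>\<infinity>k\<in>{k \<in> u \<rightarrow>\<^sub>E {1..}. pad t u k \<in> D}. ennreal (\<Prod>j\<in>u. g (k j)))"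
      by (rule mult_left_mono) simp
    moreover have "(\<Sum>k\<in>Xu. W (supp k) * ennreal (\<Prod>j\<in>supp k. g (k j)))
        = W u * (\<Sum>k\<in>Xu. ennreal (\<Prod>j\<in>u. g (k j)))"
      unfolding sum_distrib_left by (intro sum.cong) (auto simp: Xu_def)
    ultimately show "(\<Sum>k\<in>{k \<in> X. supp k = u}. W (supp k) * ennreal (\<Prod>j\<in>supp k. g (k j)))
        \<le> W u * (\<Sum>\<^sub>\<infinity>k\<in>{k \<in> u \<rightarrow>\<^sub>E {1..}. pad t u k \<in> D}. ennreal (\<Prod>j\<in>u. g (k j)))"
      by (simp add: Xu_def)
  qed
  finally show ?thesis by (simp add: U_def)
qed

theorem theorem2:
  fixes b m s d \<alpha> :: nat
    and \<gamma> :: "nat set \<Rightarrow> real"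
    and p :: "'b::prime_card mod_ring poly"
    and q :: "nat \<Rightarrow> 'b mod_ring poly"
  assumes "b = CARD('b)"
    and "m \<ge> 1" and "s \<ge> 1" and "d > 1" and "\<alpha> > 1"
    and "\<And>v. v \<subseteq> {1..s} \<Longrightarrow> \<gamma> v \<ge> 0"
    and "Polynomial.degree p = m"
  shows "worst_case_error b s \<alpha> \<gamma> (b ^ m)
           (\<lambda>n. interlace_vec b d s (lattice_point m (d * s) q p n))
         \<le> (\<Sum>u | u \<subseteq> {1..d * s} \<and> u \<noteq> {}.
              ennreal (weight_tilde b d \<alpha> \<gamma> (blocks d s u)) *
              (\<Sum>\<^sub>\<infinity>k\<in>{k \<in> u \<rightarrow>\<^sub>E {1..}. pad (d * s) u k \<in> dual_lattice m (d * s) q p}.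
                 ennreal (\<Prod>j\<in>u. r_tilde b \<alpha> d (k j))))"
    (is "_ \<le> ?B")
proof -
  have b: "b \<ge> 2" using CARD_prime_card_ge_2[where 'b = 'b] assms(1) by simp
  have d: "d \<ge> 1" using assms(4) by simp
  have p: "p \<noteq> 0" using assms(2,7) by auto
  define N where "N = b ^ m"
  have N: "N > 0" using b by (simp add: N_def)
  define D where "D = dual_lattice m (d * s) q p"
  define L :: "(nat \<Rightarrow> nat) set" where "L = {1..s} \<rightarrow>\<^sub>E UNIV"
  define l0 :: "nat \<Rightarrow> nat" where "l0 = (\<lambda>j\<in>{1..s}. 0)"
  define K where "K = deinterlace_vec b d s"
  define x where "x n = interlace_vec b d s (lattice_point m (d * s) q p n)" for n
  \<comment> \<open>The quadrature rule applied to the Walsh function of frequency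
    \<open>l\<close>.\<close>
  define A where "A l = (1 / of_nat N) * (\<Sum>n<N. wal_vec b s l (x n))" for l

  define c where "c n j a = nat (to_int_mod_ring (fls_nth (laurent (nat_poly n * q j) / laurent p) (int (Suc a))))"
    for n j a
  have c: "c n j a < b" for n j a
  proof -
    have "0 \<le> to_int_mod_ring z" "to_int_mod_ring z < int CARD('b)" for z :: "'b mod_ring"
      using range_to_int_mod_ring[where 'a = 'b] by auto
    then show ?thesis by (simp add: c_def nat_less_iff assms(1))
  qed
  have digits: "real_digit b (lattice_point m (d * s) q p n j) (Suc a) = (if a < m then c n j a else 0)"
    if "j \<in> {1..d * s}" for n j a
    using real_digit_lattice_point[OF that, of m q p n a] by (simp add: c_def assms(1))
  have cube: "x n \<in> unit_cube s" for n
    unfolding x_def by (rule interlace_vec_in_unit_cube[OF b d c digits])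
  have wal: "wal_vec b s l (x n)
      = exp (2 * pi * \<i> / b) ^ (\<Sum>j=1..d * s. \<Sum>a<m. c n j a * nat_digit b (K l j) a)" for l n
    unfolding x_def K_def by (rule wal_vec_interlace_vec[OF b d c digits])

  \<comment> \<open>Means of Walsh functions over the point set\<close>
  have A_le: "cmod (A l) \<le> 1" for l
  proof -
    have "cmod (\<Sum>n<N. wal_vec b s l (x n)) \<le> real N"
      by (rule order.trans[OF norm_sum]) simp
    then show ?thesis using N by (simp add: A_def norm_mult norm_divide)
  qed
  have A_0: "A l = 0" if "K l \<notin> D" for l
  proof -
    have "K l \<in> {1..d * s} \<rightarrow>\<^sub>E UNIV" unfolding K_def by (rule deinterlace_vec_PiE)
    from lattice_character_sum[OF assms(7) p this that[unfolded D_def]]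
    have "(\<Sum>n<N. exp (2 * pi * \<i> / b) ^ (\<Sum>j=1..d * s. \<Sum>a<m. c n j a * nat_digit b (K l j) a)) = 0"
      unfolding N_def assms(1) c_def .
    then have "(\<Sum>n<N. wal_vec b s l (x n)) = 0" by (simp only: wal)
    then show ?thesis by (simp add: A_def)
  qed
  have A_l0: "A l0 = 1" using N b by (simp add: A_def l0_def wal_vec_def)

  \<comment> \<open>The error of a single function as a Walsh series\<close>
  have "ennreal \<bar>1 / real N * (\<Sum>n<N. f (x n)) - (LINT y|cube_measure s. f y)\<bar> \<le> ?B"
    if f: "f \<in> walsh_space b s \<alpha> \<gamma>" "walsh_norm b s \<alpha> \<gamma> f \<le> 1" for f
  proof -
    define C where "C l = walsh_coeff b s f l" for l
    define E where "E = 1 / real N * (\<Sum>n<N. f (x n)) - (LINT y|cube_measure s. f y)"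
    have "((\<lambda>l. C l * wal_vec b s l (x n)) has_sum complex_of_real (f (x n))) L" for n
      using f(1) cube[of n] by (simp add: walsh_space_def C_def L_def)
    then have "((\<lambda>l. 1 / of_nat N * (\<Sum>n<N. C l * wal_vec b s l (x n)))
        has_sum (1 / of_nat N * (\<Sum>n<N. complex_of_real (f (x n))))) L"
      by (intro has_sum_cmult_right has_sum_finite_sum)
    moreover have "(\<lambda>l. 1 / of_nat N * (\<Sum>n<N. C l * wal_vec b s l (x n))) = (\<lambda>l. C l * A l)"
      by (simp add: A_def fun_eq_iff mult.left_commute flip: sum_distrib_left)
    moreover have "1 / of_nat N * (\<Sum>n<N. complex_of_real (f (x n)))
        = complex_of_real (1 / real N * (\<Sum>n<N. f (x n)))" by simp
    ultimately have "((\<lambda>l. C l * A l) has_sum complex_of_real (1 / real N * (\<Sum>n<N. f (x n)))) L"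
      by metis
    \<comment> \<open>The zero frequency contributes exactly the integral, so removing it leaves a
      series for the error.\<close>
    moreover have "((\<lambda>l. C l * A l) has_sum complex_of_real (LINT y|cube_measure s. f y)) {l0}"
      using walsh_coeff_0[OF b, of s f, folded l0_def] by (intro has_sum_finiteI) (simp_all add: A_l0 C_def)
    ultimately have "((\<lambda>l. C l * A l) has_sum complex_of_real E) (L - {l0})"
      unfolding E_def of_real_diff by (rule has_sum_Diff) (auto simp: L_def l0_def)
    then have "ennreal (cmod (complex_of_real E)) \<le> ?B"
    proof (rule norm_has_sum_le_ennreal)
      fix F assume F: "finite F" "F \<subseteq> L - {l0}"
      define F' where "F' = {l \<in> F. K l \<in> D}"
      define supp where "supp k = {j \<in> {1..d * s}. k j \<noteq> 0}" for k :: "nat \<Rightarrow> nat"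
      define W where "W u = weight_tilde b d \<alpha> \<gamma> (blocks d s u)" for u
      have W: "W u \<ge> 0" for u
      proof -
        have "blocks d s u \<subseteq> {1..s}" by (auto simp: blocks_def)
        then show ?thesis using assms(6) by (simp add: W_def weight_tilde_def)
      qed
      have rt: "r_tilde b \<alpha> d k \<ge> 0" for k by (simp add: r_tilde_def)
      have "cmod (\<Sum>l\<in>F. C l * A l) = cmod (\<Sum>l\<in>F'. C l * A l)"
        using F(1) A_0 by (intro arg_cong[where f = cmod] sum.mono_neutral_right) (auto simp: F'_def)
      also have "\<dots> \<le> (\<Sum>l\<in>F'. W (supp (K l)) * (\<Prod>j\<in>supp (K l). r_tilde b \<alpha> d (K l j)))"
      proof (rule sum_norm_le)
        fix l assume l: "l \<in> F'"
        have "cmod (C l * A l) \<le> cmod (C l)"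
          using A_le[of l] by (simp add: norm_mult mult_left_le)
        also have "\<dots> \<le> \<gamma> {j \<in> {1..s}. l j \<noteq> 0} * (\<Prod>j\<in>{j \<in> {1..s}. l j \<noteq> 0}. r_decay b \<alpha> (l j))"
          unfolding C_def by (rule walsh_coeff_le[OF f b assms(6)]) (use l F in \<open>auto simp: F'_def L_def\<close>)
        also have "\<dots> \<le> W (supp (K l)) * (\<Prod>j\<in>supp (K l). r_tilde b \<alpha> d (K l j))"
          unfolding W_def supp_def K_def
          by (rule prod_r_decay_le[OF b assms(4,5) refl assms(6) refl]) auto
        finally show "cmod (C l * A l) \<le> W (supp (K l)) * (\<Prod>j\<in>supp (K l). r_tilde b \<alpha> d (K l j))" .
      qed
      finally have "ennreal (cmod (\<Sum>l\<in>F. C l * A l))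
          \<le> ennreal (\<Sum>l\<in>F'. W (supp (K l)) * (\<Prod>j\<in>supp (K l). r_tilde b \<alpha> d (K l j)))"
        by (rule ennreal_leI)
      also have "\<dots> = (\<Sum>l\<in>F'. ennreal (W (supp (K l))) * ennreal (\<Prod>j\<in>supp (K l). r_tilde b \<alpha> d (K l j)))"
        using W rt by (simp add: ennreal_mult prod_nonneg flip: sum_ennreal)
      \<comment> \<open>Deinterlacing is injective, so no dual vector is counted twice.\<close>
      also have "\<dots> = (\<Sum>k\<in>K ` F'. ennreal (W (supp k)) * ennreal (\<Prod>j\<in>supp k. r_tilde b \<alpha> d (k j)))"
      proof -
        have "inj_on K F'" unfolding K_def
          by (rule inj_on_subset[OF inj_on_deinterlace_vec[OF b d]]) (use F in \<open>auto simp: F'_def L_def\<close>)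
        then show ?thesis by (simp add: sum.reindex)
      qed
      also have "\<dots> \<le> ?B"
        unfolding W_def D_def[symmetric]
      proof (rule sum_by_support_le)
        show "finite (K ` F')" "K ` F' \<subseteq> D" using F(1) by (auto simp: F'_def)
        show "D \<subseteq> {1..d * s} \<rightarrow>\<^sub>E UNIV" by (auto simp: D_def dual_lattice_def)
        \<comment> \<open>The zero vector lies in the dual lattice but has empty support, which the
          bound leaves out. Its only preimage is \<open>l0\<close>, already removed.\<close>
        show "(\<lambda>j\<in>{1..d * s}. 0) \<notin> K ` F'"
        proof
          assume "(\<lambda>j\<in>{1..d * s}. 0) \<in> K ` F'"
          then obtain l where l: "l \<in> F'" "K l = (\<lambda>j\<in>{1..d * s}. 0)" by auto
          have "K l0 = (\<lambda>j\<in>{1..d * s}. 0)"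
          proof (rule PiE_ext[of _ "{1..d * s}" "\<lambda>_. UNIV"])
            fix j assume j: "j \<in> {1..d * s}"
            then have "(j - 1) div d < s" using d by (auto simp: div_less_iff_less_mult mult.commute)
            with j show "K l0 j = (\<lambda>j\<in>{1..d * s}. 0) j" by (simp add: K_def deinterlace_vec_def l0_def)
          qed (auto simp: K_def deinterlace_vec_def)
          then have "l = l0"
            using l F inj_on_deinterlace_vec[OF b d, of s]
            unfolding K_def by (auto simp: F'_def L_def l0_def inj_on_def)
          then show False using l(1) F by (auto simp: F'_def)
        qed
      qed (fact supp_def)
      finally show "ennreal (cmod (\<Sum>l\<in>F. C l * A l)) \<le> ?B" .
    qed
    then show ?thesis by (simp only: norm_of_real E_def)
  qed
  then show ?thesis
    unfolding worst_case_error_def N_def x_def by (intro SUP_least) auto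
qed

end
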